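(* Let $n,K\ge 1$, let the exponential family $(P_\theta)_{\theta\in\Theta}$, the function $f$, the localizing schemes $W^{(1)},\dots,W^{(K)}$, the estimates $\widetilde\theta^{(k)}$, the aggregated estimates $\widehat\theta^{(k)}$ and $\widehat\theta=\widehat\theta^{(K)}$ be as in the context, satisfying (A1), (A2) and (A3). Let $0<\alpha\le 1$ and let the critical values $\mathfrak z_k>0$ used in the aggregation procedure satisfy the propagation condition with $r=1$: $$\sup_{\theta^*\in\Theta}\mathbf E_{\theta^*}\bigl[N_k\,\mathscr K(\widetilde\theta^{(k)},\widehat\theta^{(k)})\bigr]\le\alpha\tau_1,\qquad k=2,\dots,K,\qquad \tau_1:=2\Gamma(1)=2.$$ Let $k^*\in\{1,\dots,K\}$, $\theta\in\Theta$ and $\Delta\ge0$ be such that $\max_{k\le k^*}\Delta(W^{(k)},\theta)\le\Delta$. Then $$N_{k^*}^{1/2}\,\mathbf E_{f(\cdot)}\mathscr K^{1/2}(\widehat\theta,\theta)\le\varkappa\Bigl(2\sqrt{\tau_1e^{\Delta}}+\sqrt{c_u^2\,\overline{\mathfrak z}_{k^*}}\Bigr),$$ where $c_u=(u^{-1/2}-1)^{-1}$ and $\overline{\mathfrak z}_{k}=\max_{k\le l\le K}\mathfrak z_l$.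
   Context: Model. $X_1,\dots,X_n\in\mathbb R^d$ are deterministic design points, and $Y_1,\dots,Y_n$ are independent real random variables with $Y_i\sim P_{f(X_i)}$, where $f:\mathbb R^d\to\Theta$ is an unknown function. $\mathbf P_{f(\cdot)},\mathbf E_{f(\cdot)}$ denote the joint law and expectation; $\mathbf P_\theta,\mathbf E_\theta$ denote those when $f\equiv\theta$. (A1) $(P_\theta,\theta\in\Theta\subseteq\mathbb R)$ is dominated by a measure $P$ with densities $p(y,\theta)=p(y)e^{yC(\theta)-B(\theta)}$, where $p(y)\ge 0$, $B,C$ are nondecreasing continuously differentiable functions on $\Theta$, and $\mathbf E_\theta Y=\theta$ for all $\theta\in\Theta$ (natural parametrization). (A2) $\Theta$ is compact and convex, and the Fisher information $I(\theta)=\mathbf E_\theta|\partial\log p(Y,\theta)/\partial\theta|^2$ is positive and satisfies, for some $\varkappa\ge 1$, $|I(\theta')/I(\theta'')|^{1/2}\le\varkappa$ for all $\theta',\theta''\in\Theta$. $\mathscr K(\theta,\theta')=\mathbf E_\theta\log\{p(Y,\theta)/p(Y,\theta')\}$ is the Kullback–Leibler divergence. Localizing schemes and weak estimates. For a fixed point $x$, deterministic weights $W^{(k)}=(w_1^{(k)},\dots,w_n^{(k)})$ with $w_i^{(k)}\in[0,1]$, $k=1,\dots,K$, are given; $N_k=\sum_{i=1}^n w_i^{(k)}>0$. The local likelihood estimates are $\widetilde\theta^{(k)}=\arg\max_{\theta\in\Theta}\sum_i w_i^{(k)}\log p(Y_i,\theta)$ (equal to $\sum_i w_i^{(k)}Y_i/N_k$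 whenever the latter lies in $\Theta$). (A3) $w_i^{(k)}\ge w_i^{(k')}$ for all $i$ and all $k>k'$, and for constants $0<u_0\le u<1$, $u_0\le N_{k-1}/N_k\le u$ for every $2\le k\le K$. Modeling bias. For weights $W=(w_i)$, $\Delta(W,\theta)=\sum_i\delta(\theta,f(X_i))\mathbf 1(w_i>0)$, where $\delta(\theta,\theta')=\log \mathbf E_\theta\{p^2(Y,\theta')/p^2(Y,\theta)\}$, $Y\sim P_\theta$. Aggregation procedure (SSA). $K_{\mathrm{ag}}:[0,\infty)\to[0,1]$ is a fixed nonincreasing kernel, supported on $[0,1]$, with $K_{\mathrm{ag}}(t)=1$ for $t\le b$ for some fixed $b>0$. Given $\mathfrak z_k>0$: $\widehat\theta^{(1)}=\widetilde\theta^{(1)}$; for $k=2,\dots,K$, $\widehat\theta^{(k)}=\gamma_k\widetilde\theta^{(k)}+(1-\gamma_k)\widehat\theta^{(k-1)}$ with $\gamma_k=K_{\mathrm{ag}}(\mathbf m^{(k)}/\mathfrak z_k)$, $\mathbf m^{(k)}=N_k\mathscr K(\widetilde\theta^{(k)},\widehat\theta^{(k-1)})$. The final estimate is $\widehat\theta=\widehat\theta^{(K)}$. *)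

theory Defs
  imports "HOL-Probability.Probability"
begin

section \<open>Exponential families in natural parametrization\<close>

text \<open>The functions \<open>comp_B\<close> and \<open>comp_C\<close> matter only on the parameter set \<open>params\<close>.\<close>

record expfam =
  dominating :: "real measure"
  base_dens :: "real \<Rightarrow> real"
  comp_B :: "real \<Rightarrow> real"
  comp_C :: "real \<Rightarrow> real"
  params :: "real set"

definition dens :: "expfam \<Rightarrow> real \<Rightarrow> real \<Rightarrow> real" where
  "dens F y \<theta> = base_dens F y * exp (y * comp_C F \<theta> - comp_B F \<theta>)"

definition law :: "expfam \<Rightarrow> real \<Rightarrow> real measure" where
  "law F \<theta> = density (dominating F) (\<lambda>y. ennreal (dens F y \<theta>))"

definition C1_within :: "real set \<Rightarrow> (real \<Rightarrow> real) \<Rightarrow> bool" where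
  "C1_within S g \<longleftrightarrow>
     (\<exists>g'. (\<forall>t\<in>S. (g has_real_derivative g' t) (at t within S)) \<and> continuous_on S g')"

definition cond_A1 :: "expfam \<Rightarrow> bool" where
  "cond_A1 F \<longleftrightarrow>
     sets (dominating F) = sets borel \<and>
     base_dens F \<in> borel_measurable borel \<and> (\<forall>y. 0 \<le> base_dens F y) \<and>
     (\<forall>\<theta>\<in>params F. prob_space (law F \<theta>)) \<and>
     mono_on (params F) (comp_B F) \<and> C1_within (params F) (comp_B F) \<and>
     mono_on (params F) (comp_C F) \<and> C1_within (params F) (comp_C F) \<and>
     (\<forall>\<theta>\<in>params F. integrable (law F \<theta>) (\<lambda>y. y) \<and> (\<integral>y. y \<partial>law F \<theta>) = \<theta>)"

text \<open>
  At an endpoint of the parameter interval the score is a one-sided derivative. Points \<open>y\<close> with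
  \<open>base_dens F y = 0\<close>, where \<open>ln 0 = 0\<close> takes effect here and below, form a null set of every
  \<open>law F \<theta>\<close>.
\<close>

definition fisher_info :: "expfam \<Rightarrow> real \<Rightarrow> real" where
  "fisher_info F \<theta> =
     (\<integral>y. \<bar>vector_derivative (\<lambda>t. ln (dens F y t)) (at \<theta> within params F)\<bar>\<^sup>2 \<partial>law F \<theta>)"

text \<open>Positivity also forces the score to be square integrable, since otherwise the
  Bochner integral is \<open>0\<close>.\<close>

definition cond_A2 :: "expfam \<Rightarrow> real \<Rightarrow> bool" where
  "cond_A2 F \<kappa> \<longleftrightarrow>
     compact (params F) \<and> convex (params F) \<and>
     (\<forall>\<theta>\<in>params F. 0 < fisher_info F \<theta>) \<and> 1 \<le> \<kappa> \<and>
     (\<forall>\<theta>'\<in>params F. \<forall>\<theta>''\<in>params F. sqrt \<bar>fisher_info F \<theta>' / fisher_info F \<theta>''\<bar> \<le> \<kappa>)"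

definition KL :: "expfam \<Rightarrow> real \<Rightarrow> real \<Rightarrow> real" where
  "KL F \<theta> \<theta>' = (\<integral>y. ln (dens F y \<theta> / dens F y \<theta>') \<partial>law F \<theta>)"


section \<open>Modeling bias\<close>

text \<open>
  The expectation inside the logarithm may be infinite, so it is taken as a nonnegative integral and
  the bias is extended-real valued. This expectation is at least \<open>1\<close> by Jensen's inequality, so
  the bias is nonnegative.
\<close>

definition log_ennreal :: "ennreal \<Rightarrow> ereal" where
  "log_ennreal a = (if a = \<infinity> then \<infinity> else if a = 0 then -\<infinity> else ereal (ln (enn2real a)))"

definition delta :: "expfam \<Rightarrow> real \<Rightarrow> real \<Rightarrow> ereal" where
  "delta F \<theta> \<theta>' =
     log_ennreal (\<integral>\<^sup>+y. ennreal ((dens F y \<theta>')\<^sup>2 / (dens F y \<theta>)\<^sup>2) \<partial>law F \<theta>)"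

text \<open>Throughout, \<open>n\<close> is the sample size, observations are indexed by \<open>{1..n}\<close>, and
  \<open>w k i\<close> is the weight of observation \<open>i\<close> in the \<open>k\<close>-th localizing scheme.\<close>

definition modeling_bias ::
  "expfam \<Rightarrow> nat \<Rightarrow> (nat \<Rightarrow> 'x) \<Rightarrow> ('x \<Rightarrow> real) \<Rightarrow> (nat \<Rightarrow> real) \<Rightarrow> real \<Rightarrow> ereal" where
  "modeling_bias F n X f W \<theta> = (\<Sum>i=1..n. if 0 < W i then delta F \<theta> (f (X i)) else 0)"


section \<open>Model and localizing schemes\<close>

text \<open>The joint law of independent observations with \<open>i\<close>-th marginal \<open>law F (f (X i))\<close>; the
  observations are the coordinates of the sample point.\<close>

definition joint_law ::
  "expfam \<Rightarrow> nat \<Rightarrow> (nat \<Rightarrow> 'x) \<Rightarrow> ('x \<Rightarrow> real) \<Rightarrow> (nat \<Rightarrow> real) measure" where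
  "joint_law F n X f = PiM {1..n} (\<lambda>i. law F (f (X i)))"

definition local_size :: "nat \<Rightarrow> (nat \<Rightarrow> real) \<Rightarrow> real" where
  "local_size n W = (\<Sum>i=1..n. W i)"

definition localizing_schemes :: "nat \<Rightarrow> nat \<Rightarrow> (nat \<Rightarrow> nat \<Rightarrow> real) \<Rightarrow> bool" where
  "localizing_schemes n K w \<longleftrightarrow>
     (\<forall>k\<in>{1..K}. (\<forall>i\<in>{1..n}. 0 \<le> w k i \<and> w k i \<le> 1) \<and> 0 < local_size n (w k))"

definition cond_A3 :: "nat \<Rightarrow> nat \<Rightarrow> (nat \<Rightarrow> nat \<Rightarrow> real) \<Rightarrow> real \<Rightarrow> real \<Rightarrow> bool" where
  "cond_A3 n K w u0 u \<longleftrightarrow>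
     (\<forall>k\<in>{1..K}. \<forall>k'\<in>{1..K}. k' < k \<longrightarrow> (\<forall>i\<in>{1..n}. w k' i \<le> w k i)) \<and>
     0 < u0 \<and> u0 \<le> u \<and> u < 1 \<and>
     (\<forall>k\<in>{2..K}. u0 \<le> local_size n (w (k - 1)) / local_size n (w k) \<and>
                  local_size n (w (k - 1)) / local_size n (w k) \<le> u)"

text \<open>The maximizer is almost surely unique: under the regularity conditions it is the weighted
  mean of the observations, projected onto the parameter interval.\<close>

definition local_mle :: "expfam \<Rightarrow> nat \<Rightarrow> (nat \<Rightarrow> real) \<Rightarrow> (nat \<Rightarrow> real) \<Rightarrow> real" where
  "local_mle F n W y = (ARG_MAX (\<lambda>t. \<Sum>i=1..n. W i * ln (dens F (y i) t)) t. t \<in> params F)"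


section \<open>Aggregation procedure\<close>

definition aggregation_kernel :: "(real \<Rightarrow> real) \<Rightarrow> real \<Rightarrow> bool" where
  "aggregation_kernel Kag b \<longleftrightarrow>
     (\<forall>t\<ge>0. 0 \<le> Kag t \<and> Kag t \<le> 1) \<and> antimono_on {0..} Kag \<and>
     (\<forall>t>1. Kag t = 0) \<and> 0 < b \<and> (\<forall>t\<in>{0..b}. Kag t = 1)"

text \<open>The steps are numbered from \<open>1\<close>; the value at \<open>0\<close> is a dummy.\<close>

primrec aggregate ::
  "expfam \<Rightarrow> nat \<Rightarrow> (nat \<Rightarrow> nat \<Rightarrow> real) \<Rightarrow> (real \<Rightarrow> real) \<Rightarrow> (nat \<Rightarrow> real) \<Rightarrow>
   (nat \<Rightarrow> real) \<Rightarrow> nat \<Rightarrow> real" where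
  "aggregate F n w Kag z y 0 = 0"
| "aggregate F n w Kag z y (Suc j) =
     (if j = 0 then local_mle F n (w 1) y
      else let k = Suc j;
               mle = local_mle F n (w k) y;
               prev = aggregate F n w Kag z y j;
               m = local_size n (w k) * KL F mle prev;
               \<gamma> = Kag (m / z k)
           in \<gamma> * mle + (1 - \<gamma>) * prev)"

definition tau1 :: real where
  "tau1 = 2 * Gamma 1"

definition propagation_condition ::
  "expfam \<Rightarrow> nat \<Rightarrow> (nat \<Rightarrow> 'x) \<Rightarrow> nat \<Rightarrow> (nat \<Rightarrow> nat \<Rightarrow> real) \<Rightarrow> (real \<Rightarrow> real) \<Rightarrow>
   (nat \<Rightarrow> real) \<Rightarrow> real \<Rightarrow> bool" where
  "propagation_condition F n X K w Kag z \<alpha> \<longleftrightarrow>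
     (\<forall>k\<in>{2..K}.
        (SUP \<theta>\<in>params F.
           ereal (\<integral>y. local_size n (w k) * KL F (local_mle F n (w k) y) (aggregate F n w Kag z y k)
                    \<partial>joint_law F n X (\<lambda>_. \<theta>)))
        \<le> ereal (\<alpha> * tau1))"

end

(*
  For an exponential family in the natural parametrization, B' = t C' and C' is the Fisher
  information, so KL(s,t) is the integral of (r - s) C'(r) between s and t. Hence KL^(1/2) is
  comparable to |s - t| with constants whose ratio is at most kappa, and it obeys a triangle
  inequality up to the factor kappa. The distance from the final estimate to theta is split at
  step k*. After k*, a nonzero aggregation step can only occur when its test statistic is below
  the critical value, so the steps form a geometric series with sum c_u. Up to k*, all estimates
  depend only on observations with positive weight at step k*. Changing the measure to P_theta on
  these coordinates costs exp(Delta / 2) by Cauchy-Schwarz, and under P_theta the propagation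
  condition and the variance of the weighted mean bound both remaining terms.
*)

theory Submission
  imports Defs
begin

section \<open>Product measures\<close>

text \<open>The factor \<kappa> must be paid only once. An approximate triangle inequality for
  KL^(1/2), applied at every aggregation step, would multiply such factors. All pieces are therefore
  measured as \<open>sqrt (m / 2)\<close> times a distance, with \<open>m\<close> the minimum of
  \<open>C'\<close>: there the triangle inequality is exact, and this quantity never exceeds
  KL^(1/2). Only the total is converted back, through the maximum \<open>M\<close> of
  \<open>C'\<close>, and \<open>sqrt M / sqrt m\<close> is at most \<kappa> by (A2). Cauchy-Schwarz
  asks for the second moment of KL^(1/2), that is, the mean of KL; this is why the propagation
  condition with r = 1 is the fitting one. The constant 2 counts the two random errors at step
  \<open>ks\<close>: weak estimate against \<theta>, and aggregated against weak estimate. The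
  delicate analytic point is that \<open>C'\<close> is the Fisher information. (A1) speaks of means,
  while the error of the weak estimate needs a variance; the variance at a parameter is recovered
  from the means at neighbouring parameters.\<close>

text \<open>A finite product is determined by its values on rectangles, and there both the density
  and the indicator factor over the coordinates.\<close>

lemma PiM_density:
  fixes M :: "'i \<Rightarrow> 'a measure"
  assumes "finite I" and M: "\<And>i. prob_space (M i)"
    and r: "\<And>i. r i \<in> borel_measurable (M i)"
    and Mr: "\<And>i. prob_space (density (M i) (r i))"
  shows "PiM I (\<lambda>i. density (M i) (r i)) = density (PiM I M) (\<lambda>x. \<Prod>i\<in>I. r i (x i))"
proof -
  interpret M: product_prob_space M I
    by (intro product_prob_spaceI M)
  interpret D: product_prob_space "\<lambda>i. density (M i) (r i)" I
    by (intro product_prob_spaceI Mr)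
  have meas: "(\<lambda>x. \<Prod>i\<in>I. g i (x i)) \<in> borel_measurable (PiM I M)"
    if "\<And>i. i \<in> I \<Longrightarrow> g i \<in> borel_measurable (M i)" for g :: "'i \<Rightarrow> 'a \<Rightarrow> ennreal"
    using that by (intro borel_measurable_prod_ennreal)
      (auto intro: measurable_compose[OF measurable_component_singleton])
  have "density (PiM I M) (\<lambda>x. \<Prod>i\<in>I. r i (x i)) = PiM I (\<lambda>i. density (M i) (r i))"
  proof (rule D.PiM_eqI)
    show "sets (density (PiM I M) (\<lambda>x. \<Prod>i\<in>I. r i (x i))) = PiM I (\<lambda>i. density (M i) (r i))"
      by (simp cong: sets_PiM_cong)
    fix A assume A: "\<And>i. i \<in> I \<Longrightarrow> A i \<in> sets (density (M i) (r i))"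
    have "Pi\<^sub>E I A \<in> sets (PiM I M)"
      using A assms(1) by (intro sets_PiM_I_finite) auto
    then have "density (PiM I M) (\<lambda>x. \<Prod>i\<in>I. r i (x i)) (Pi\<^sub>E I A)
        = (\<integral>\<^sup>+x. (\<Prod>i\<in>I. r i (x i)) * indicator (Pi\<^sub>E I A) x \<partial>PiM I M)"
      using r by (intro emeasure_density meas)
    also have "\<dots> = (\<integral>\<^sup>+x. (\<Prod>i\<in>I. r i (x i) * indicator (A i) (x i)) \<partial>PiM I M)"
    proof (rule nn_integral_cong)
      fix x assume "x \<in> space (PiM I M)"
      then have "indicator (Pi\<^sub>E I A) x = (\<Prod>i\<in>I. indicator (A i) (x i) :: ennreal)"
        using assms(1) by (auto simp: space_PiM indicator_def PiE_iff prod_zero_iff intro!: prod.neutral)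
      then show "(\<Prod>i\<in>I. r i (x i)) * indicator (Pi\<^sub>E I A) x
          = (\<Prod>i\<in>I. r i (x i) * indicator (A i) (x i))"
        by (simp add: prod.distrib)
    qed
    also have "\<dots> = (\<Prod>i\<in>I. \<integral>\<^sup>+x. r i x * indicator (A i) x \<partial>M i)"
      using assms(1) r A by (intro M.product_nn_integral_prod) auto
    also have "\<dots> = (\<Prod>i\<in>I. emeasure (density (M i) (r i)) (A i))"
      using r A by (intro prod.cong refl) (simp add: emeasure_density)
    finally show "density (PiM I M) (\<lambda>x. \<Prod>i\<in>I. r i (x i)) (Pi\<^sub>E I A)
        = (\<Prod>i\<in>I. emeasure (density (M i) (r i)) (A i))" .
  qed fact
  then show ?thesis ..
qed

text \<open>The marginal of the product on the coordinates in \<open>S\<close> is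
  \<open>PiM S M\<close>. The same \<open>h\<close> is read on two spaces; this is consistent by
  \<open>dep\<close>, as points of \<open>PiM S M\<close> are \<open>undefined\<close> outside
  \<open>S\<close>.\<close>

lemma nn_integral_PiM_restrict:
  fixes M :: "'i \<Rightarrow> 'a measure"
  assumes "finite I" "S \<subseteq> I" and M: "\<And>i. prob_space (M i)"
    and h: "h \<in> borel_measurable (PiM S M)" and dep: "\<And>x. h (restrict x S) = h x"
  shows "(\<integral>\<^sup>+x. h x \<partial>PiM I M) = (\<integral>\<^sup>+x. h x \<partial>PiM S M)"
proof -
  interpret M: product_prob_space M I
    by (intro product_prob_spaceI M)
  have "(\<integral>\<^sup>+x. h x \<partial>PiM S M) = (\<integral>\<^sup>+x. h (restrict x S) \<partial>PiM I M)"
    using assms(2) by (subst M.distr_restrict[OF assms(2,1)], subst nn_integral_distr)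
      (auto intro: measurable_restrict_subset h)
  then show ?thesis by (simp add: dep)
qed

text \<open>The change of measure behind the modeling bias: only the coordinates that \<open>h\<close> depends on
  contribute to the second moment of the likelihood ratio.\<close>

lemma nn_integral_change_of_measure:
  fixes P Q :: "'i \<Rightarrow> 'a measure"
  assumes fin: "finite I" "S \<subseteq> I"
    and P: "\<And>i. prob_space (P i)" and Q: "\<And>i. prob_space (Q i)"
    and r: "\<And>i. r i \<in> borel_measurable (Q i)" and PQ: "\<And>i. P i = density (Q i) (r i)"
    and h: "h \<in> borel_measurable (PiM S Q)" and dep: "\<And>x. h (restrict x S) = h x"
  shows "(\<integral>\<^sup>+x. h x \<partial>PiM I P)\<^sup>2
    \<le> (\<integral>\<^sup>+x. (h x)\<^sup>2 \<partial>PiM I Q) * (\<Prod>i\<in>S. \<integral>\<^sup>+x. (r i x)\<^sup>2 \<partial>Q i)"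
proof -
  interpret Q: product_prob_space Q S
    by (intro product_prob_spaceI Q)
  have S: "finite S" using fin by (rule finite_subset[rotated])
  have meas: "(\<lambda>x. \<Prod>i\<in>S. r i (x i)) \<in> borel_measurable (PiM S Q)"
    using r by (intro borel_measurable_prod_ennreal)
      (auto intro: measurable_compose[OF measurable_component_singleton])
  have "sets (PiM S P) = sets (PiM S Q)"
    by (intro sets_PiM_cong) (simp_all add: PQ)
  then have h': "h \<in> borel_measurable (PiM S P)"
    using h measurable_cong_sets by blast
  have "PiM S P = PiM S (\<lambda>i. density (Q i) (r i))"
    by (intro PiM_cong refl PQ)
  also have "\<dots> = density (PiM S Q) (\<lambda>x. \<Prod>i\<in>S. r i (x i))"
    using P by (intro PiM_density S Q r) (simp add: PQ)
  finally have PS: "PiM S P = density (PiM S Q) (\<lambda>x. \<Prod>i\<in>S. r i (x i))" .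
  have "(\<integral>\<^sup>+x. h x \<partial>PiM I P) = (\<integral>\<^sup>+x. h x \<partial>PiM S P)"
    using fin P h' dep by (rule nn_integral_PiM_restrict)
  also have "\<dots> = (\<integral>\<^sup>+x. (\<Prod>i\<in>S. r i (x i)) * h x \<partial>PiM S Q)"
    unfolding PS using meas h by (rule nn_integral_density)
  also have "\<dots>\<^sup>2 \<le> (\<integral>\<^sup>+x. (\<Prod>i\<in>S. r i (x i))\<^sup>2 \<partial>PiM S Q) * (\<integral>\<^sup>+x. (h x)\<^sup>2 \<partial>PiM S Q)"
    using meas h by (rule Cauchy_Schwarz_nn_integral)
  also have "(\<integral>\<^sup>+x. (\<Prod>i\<in>S. r i (x i))\<^sup>2 \<partial>PiM S Q) = (\<Prod>i\<in>S. \<integral>\<^sup>+x. (r i x)\<^sup>2 \<partial>Q i)"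
    unfolding prod_power_distrib
    using S r by (intro Q.product_nn_integral_prod) auto
  also have "(\<integral>\<^sup>+x. (h x)\<^sup>2 \<partial>PiM S Q) = (\<integral>\<^sup>+x. (h x)\<^sup>2 \<partial>PiM I Q)"
    using h dep by (intro nn_integral_PiM_restrict[symmetric] fin Q) auto
  finally show ?thesis by (simp add: mult.commute)
qed

text \<open>Independent centered variables are orthogonal, so in the expanded square only the
  diagonal survives.\<close>

lemma integral_PiM_sum_square:
  fixes M :: "'i \<Rightarrow> 'a measure" and g :: "'i \<Rightarrow> 'a \<Rightarrow> real"
  assumes fin: "finite I" and M: "\<And>i. prob_space (M i)"
    and g: "\<And>i. i \<in> I \<Longrightarrow> integrable (M i) (g i)"
    and g0: "\<And>i. i \<in> I \<Longrightarrow> integral\<^sup>L (M i) (g i) = 0"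
    and g2: "\<And>i. i \<in> I \<Longrightarrow> integrable (M i) (\<lambda>x. (g i x)\<^sup>2)"
  shows "integrable (PiM I M) (\<lambda>x. (\<Sum>i\<in>I. g i (x i))\<^sup>2)"
    and "(\<integral>x. (\<Sum>i\<in>I. g i (x i))\<^sup>2 \<partial>PiM I M) = (\<Sum>i\<in>I. \<integral>x. (g i x)\<^sup>2 \<partial>M i)"
proof -
  interpret M: product_prob_space M I
    by (intro product_prob_spaceI M)
  \<comment> \<open>Writes \<open>g i (x i) * g j (x j)\<close> as a product over all coordinates,
    the form that Fubini for products accepts. For \<open>i = j\<close> both factors fall on the
    same coordinate and give the square.\<close>
  define H where "H i j k x = (if k = i then g i x else 1) * (if k = j then g j x else 1)"
    for i j k and x :: 'a
  have one: "(\<integral>x. 1 \<partial>M k) = (1 :: real)" for k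
    using prob_space.prob_space[OF M[of k]] by simp
  have H_int: "integrable (M k) (H i j k)"
    and H_val: "integral\<^sup>L (M k) (H i j k) =
      (if k = i \<and> k = j then \<integral>x. (g i x)\<^sup>2 \<partial>M i else if k = i \<or> k = j then 0 else 1)"
    if "i \<in> I" "j \<in> I" for i j k
  proof -
    consider "k = i" "k = j" | "k = i" "k \<noteq> j" | "k \<noteq> i" "k = j" | "k \<noteq> i" "k \<noteq> j" by blast
    then have "integrable (M k) (H i j k) \<and> integral\<^sup>L (M k) (H i j k) =
      (if k = i \<and> k = j then \<integral>x. (g i x)\<^sup>2 \<partial>M i else if k = i \<or> k = j then 0 else 1)"
    proof cases
      case 1
      then have "H i j k = (\<lambda>x. (g i x)\<^sup>2)" by (simp add: H_def fun_eq_iff power2_eq_square)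
      then show ?thesis using g2 that 1 by simp
    next
      case 2
      then have "H i j k = g i" by (simp add: H_def fun_eq_iff)
      then show ?thesis using g g0 that 2 by simp
    next
      case 3
      then have "H i j k = g j" by (simp add: H_def fun_eq_iff)
      then show ?thesis using g g0 that 3 by simp
    next
      case 4
      then have "H i j k = (\<lambda>_. 1)" by (simp add: H_def fun_eq_iff)
      then show ?thesis using 4 one[of k] prob_space.finite_measure[OF M[of k]]
        by (simp add: finite_measure.integrable_const)
    qed
    then show "integrable (M k) (H i j k)" "integral\<^sup>L (M k) (H i j k) =
      (if k = i \<and> k = j then \<integral>x. (g i x)\<^sup>2 \<partial>M i else if k = i \<or> k = j then 0 else 1)"
      by auto
  qed
  have prod_H: "(\<Prod>k\<in>I. H i j k (x k)) = g i (x i) * g j (x j)" if "i \<in> I" "j \<in> I" for i j x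
    using fin that by (simp add: H_def prod.distrib)
  have prod_int: "integrable (PiM I M) (\<lambda>x. g i (x i) * g j (x j))" if "i \<in> I" "j \<in> I" for i j
    using M.product_integrable_prod[OF fin, of "H i j"] H_int[OF that] by (simp add: prod_H[OF that])
  have prod_val: "(\<integral>x. g i (x i) * g j (x j) \<partial>PiM I M) = (if i = j then \<integral>x. (g i x)\<^sup>2 \<partial>M i else 0)"
    if "i \<in> I" "j \<in> I" for i j
  proof -
    have "(\<integral>x. g i (x i) * g j (x j) \<partial>PiM I M) = (\<Prod>k\<in>I. integral\<^sup>L (M k) (H i j k))"
      using M.product_integral_prod[OF fin, of "H i j"] H_int[OF that] by (simp add: prod_H[OF that])
    also have "\<dots> = (if i = j then \<integral>x. (g i x)\<^sup>2 \<partial>M i else 0)"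
    proof (cases "i = j")
      case True
      have "(\<Prod>k\<in>I. integral\<^sup>L (M k) (H i j k)) = (\<Prod>k\<in>I. if k = i then \<integral>x. (g i x)\<^sup>2 \<partial>M i else 1)"
        unfolding H_val[OF that] using True by (intro prod.cong refl) simp
      then show ?thesis using True fin that by simp
    next
      case False
      have "\<exists>k\<in>I. integral\<^sup>L (M k) (H i j k) = 0"
        by (rule bexI[OF _ that(1)]) (simp add: H_val[OF that] False)
      then show ?thesis using False fin by (simp add: prod_zero)
    qed
    finally show ?thesis .
  qed
  have sq: "(\<Sum>i\<in>I. g i (x i))\<^sup>2 = (\<Sum>i\<in>I. \<Sum>j\<in>I. g i (x i) * g j (x j))" for x
    by (simp add: power2_eq_square sum_product)
  show "integrable (PiM I M) (\<lambda>x. (\<Sum>i\<in>I. g i (x i))\<^sup>2)"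
    unfolding sq by (intro Bochner_Integration.integrable_sum prod_int)
  have "(\<integral>x. (\<Sum>i\<in>I. g i (x i))\<^sup>2 \<partial>PiM I M) =
      (\<Sum>i\<in>I. \<Sum>j\<in>I. \<integral>x. g i (x i) * g j (x j) \<partial>PiM I M)"
    unfolding sq by (simp add: Bochner_Integration.integral_sum Bochner_Integration.integrable_sum prod_int)
  also have "\<dots> = (\<Sum>i\<in>I. \<Sum>j\<in>I. if i = j then \<integral>x. (g i x)\<^sup>2 \<partial>M i else 0)"
    by (intro sum.cong refl prod_val)
  also have "\<dots> = (\<Sum>i\<in>I. \<integral>x. (g i x)\<^sup>2 \<partial>M i)"
    using fin by simp
  finally show "(\<integral>x. (\<Sum>i\<in>I. g i (x i))\<^sup>2 \<partial>PiM I M) = (\<Sum>i\<in>I. \<integral>x. (g i x)\<^sup>2 \<partial>M i)" .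
qed

text \<open>A factor \<infinity> cannot occur, because in \<open>ereal\<close> one summand
  \<infinity> makes the sum \<infinity> even next to -\<infinity>. A factor 0 makes the product 0.
  Otherwise everything is a positive real and the logarithm can be undone.\<close>

lemma prod_le_exp_sum_log_ennreal:
  assumes "finite S" and le: "(\<Sum>i\<in>S. log_ennreal (a i)) \<le> ereal \<Delta>"
  shows "(\<Prod>i\<in>S. a i) \<le> ennreal (exp \<Delta>)"
proof -
  have "log_ennreal (a i) \<noteq> \<infinity>" if i: "i \<in> S" for i
    using i le assms(1) sum_Pinfty[of "\<lambda>i. log_ennreal (a i)" S] by auto
  then have fin: "a i \<noteq> \<infinity>" if "i \<in> S" for i
    using that by (metis log_ennreal_def)
  show ?thesis
  proof (cases "\<exists>i\<in>S. a i = 0")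
    case True
    then have "(\<Prod>i\<in>S. a i) = 0" by (rule prod_zero[OF assms(1)])
    then show ?thesis by (simp only: zero_le)
  next
    case False
    define c where "c i = enn2real (a i)" for i
    have a: "a i = ennreal (c i)" "0 < c i" if "i \<in> S" for i
      using fin[OF that] False that
      by (auto simp: c_def ennreal_enn2real_if enn2real_positive_iff less_top zero_less_iff_neq_zero)
    have "ereal (\<Sum>i\<in>S. ln (c i)) = (\<Sum>i\<in>S. log_ennreal (a i))"
      unfolding sum_ereal[symmetric]
      using fin False by (intro sum.cong refl) (auto simp: log_ennreal_def c_def)
    from le[folded this] have "(\<Sum>i\<in>S. ln (c i)) \<le> \<Delta>" by simp
    then have "exp (\<Sum>i\<in>S. ln (c i)) \<le> exp \<Delta>" by simp
    also have "exp (\<Sum>i\<in>S. ln (c i)) = (\<Prod>i\<in>S. c i)"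
      using a assms(1) by (simp add: exp_sum)
    finally have "ennreal (\<Prod>i\<in>S. c i) \<le> ennreal (exp \<Delta>)"
      by (rule ennreal_leI)
    also have "ennreal (\<Prod>i\<in>S. c i) = (\<Prod>i\<in>S. a i)"
      using a by (subst prod_ennreal[symmetric]) (auto simp: less_imp_le)
    finally show ?thesis .
  qed
qed

section \<open>Analysis of the exponential family\<close>

text \<open>The quotient is nonnegative because \<open>exp (x * c) - 1\<close> has the sign of
  \<open>x * c\<close>. If \<open>x * h\<close> is positive, the chord of the exponential from 0 to
  \<open>x * k\<close> lies above it and gives the second summand; otherwise
  \<open>exp v \<ge> 1 + v\<close> gives the square. The assumptions say that \<open>h\<close> lies
  between 0 and \<open>k\<close>, on the same side of 0.\<close>

lemma abs_mult_expm1_div_le: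
  fixes x h k :: real
  assumes "h \<noteq> 0" "0 < h / k" "h / k \<le> 1"
  shows "\<bar>x * (exp (x * h) - 1) / h\<bar> \<le> x\<^sup>2 + x * (exp (x * k) - 1) / k"
proof -
  have nonneg: "0 \<le> x * (exp (x * c) - 1) / c" for c :: real
  proof (cases "0 \<le> x * c")
    have sgn: "x / c = x * c / c\<^sup>2" by (simp add: power2_eq_square)
    case True
    then have "0 \<le> exp (x * c) - 1" by simp
    moreover from True have "0 \<le> x / c" unfolding sgn by (rule divide_nonneg_nonneg) simp
    ultimately have "0 \<le> x / c * (exp (x * c) - 1)" by (rule mult_nonneg_nonneg[rotated])
    then show ?thesis by simp
  next
    have sgn: "x / c = x * c / c\<^sup>2" by (simp add: power2_eq_square)
    case False
    then have "exp (x * c) - 1 \<le> 0" by simp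
    moreover from False have "x / c \<le> 0" unfolding sgn by (intro divide_nonpos_nonneg) simp_all
    ultimately have "0 \<le> x / c * (exp (x * c) - 1)" by (intro mult_nonpos_nonpos)
    then show ?thesis by simp
  qed
  have k: "k \<noteq> 0" using assms(2) by auto
  have "x * (exp (x * h) - 1) / h \<le> x\<^sup>2 + x * (exp (x * k) - 1) / k"
  proof (cases "0 < x * h")
    case True
    have "exp ((1 - h / k) * 0 + h / k * (x * k)) \<le> (1 - h / k) * exp 0 + h / k * exp (x * k)"
      using convex_onD[OF convex_on_exp[of 1], of "h / k" 0 "x * k"] assms by simp
    then have "exp (x * h) - 1 \<le> h / k * (exp (x * k) - 1)"
      using k by (simp add: algebra_simps)
    moreover have "0 < x / h" using True by (simp add: zero_less_mult_iff zero_less_divide_iff)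
    ultimately have "x / h * (exp (x * h) - 1) \<le> x / h * (h / k * (exp (x * k) - 1))"
      by (intro mult_left_mono) auto
    then show ?thesis
      using assms(1) k by (simp add: add_increasing)
  next
    case False
    then have "x / h \<le> 0" by (simp add: not_less mult_le_0_iff divide_le_0_iff)
    moreover have "x * h \<le> exp (x * h) - 1" using exp_ge_add_one_self[of "x * h"] by linarith
    ultimately have "x / h * (exp (x * h) - 1) \<le> x / h * (x * h)"
      by (rule mult_left_mono_neg[rotated])
    then show ?thesis
      using assms(1) nonneg[of k] by (simp add: power2_eq_square)
  qed
  then show ?thesis using nonneg[of h] by simp
qed

text \<open>Such a \<open>g\<close> falls up to \<open>s\<close> and rises afterwards, so its
  minimum is \<open>g s = 0\<close>. This is what compares the divergence with parabolas.\<close>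

lemma nonneg_of_deriv_sign:
  fixes g d :: "real \<Rightarrow> real"
  assumes deriv: "\<And>r. r \<in> {a..b} \<Longrightarrow> (g has_real_derivative (r - s) * d r) (at r within {a..b})"
    and d: "\<And>r. r \<in> {a..b} \<Longrightarrow> 0 \<le> d r"
    and s: "s \<in> {a..b}" "g s = 0" and t: "t \<in> {a..b}"
  shows "0 \<le> g t"
proof (cases "s \<le> t")
  case True
  have "\<exists>r\<in>{s..t}. g t - g s = (r - s) * d r * (t - s)"
    by (rule mvt_very_simple[OF True])
       (use s t in \<open>auto intro!: has_derivative_subset[OF deriv[unfolded has_field_derivative_def]]\<close>)
  then obtain r where "r \<in> {s..t}" "g t - g s = (r - s) * d r * (t - s)" by blast
  then show ?thesis using s t d[of r] True by auto
next
  case False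
  then have "t \<le> s" by simp
  then have "\<exists>r\<in>{t..s}. g s - g t = (r - s) * d r * (s - t)"
    by (rule mvt_very_simple)
       (use s t in \<open>auto intro!: has_derivative_subset[OF deriv[unfolded has_field_derivative_def]]\<close>)
  then obtain r where r: "r \<in> {t..s}" "g s - g t = (r - s) * d r * (s - t)" by blast
  then have "(s - r) * d r * (s - t) \<ge> 0" using s t d[of r] by auto
  then show ?thesis using r s by (simp add: algebra_simps)
qed

lemma has_real_derivative_half_square:
  "((\<lambda>t::real. c / 2 * (t - s)\<^sup>2) has_real_derivative (r - s) * c) (at r within A)"
  by (auto intro!: derivative_eq_intros)

text \<open>Where the density vanishes, \<open>0 / 0 = 0\<close> and \<open>ln 0 = 0\<close> take
  effect. Stated outside the locale because it also serves the case of a single parameter.\<close>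

lemma KL_self: "KL F \<theta> \<theta> = 0"
proof -
  have "ln (x / x) = (0 :: real)" for x by (cases "x = 0") simp_all
  then show ?thesis by (simp add: KL_def)
qed

text \<open>The interval is nondegenerate: within a single point the filter
  \<open>at t within {t}\<close> is trivial and every number is a derivative.\<close>

locale exponential_family =
  fixes F :: expfam and lo hi :: real and C' B' :: "real \<Rightarrow> real"
  assumes A1: "cond_A1 F"
    and params_eq: "params F = {lo..hi}" and lo_less_hi: "lo < hi"
    and deriv_C: "\<And>t. t \<in> {lo..hi} \<Longrightarrow>
      (comp_C F has_real_derivative C' t) (at t within {lo..hi})"
    and deriv_B: "\<And>t. t \<in> {lo..hi} \<Longrightarrow>
      (comp_B F has_real_derivative B' t) (at t within {lo..hi})"
    and cont_C': "continuous_on {lo..hi} C'"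
    and fisher_pos: "\<And>t. t \<in> {lo..hi} \<Longrightarrow> 0 < fisher_info F t"
begin

section \<open>Laws, densities and likelihood ratios\<close>

lemma sets_dominating [measurable_cong]: "sets (dominating F) = sets borel"
  using A1 by (simp add: cond_A1_def)

lemma sets_law [measurable_cong, simp]: "sets (law F t) = sets borel"
  by (simp add: law_def sets_dominating)

lemma space_law [simp]: "space (law F t) = UNIV"
  by (metis sets_law sets_eq_imp_space_eq space_borel)

lemma base_dens_measurable [measurable]: "base_dens F \<in> borel_measurable borel"
  using A1 by (simp add: cond_A1_def)

lemma base_dens_nonneg: "0 \<le> base_dens F y"
  using A1 by (simp add: cond_A1_def)

lemma dens_measurable [measurable]: "(\<lambda>y. dens F y t) \<in> borel_measurable borel"
  unfolding dens_def by measurable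

lemma prob_space_law: "t \<in> {lo..hi} \<Longrightarrow> prob_space (law F t)"
  using A1 params_eq by (simp add: cond_A1_def)

lemma measure_law_UNIV: "t \<in> {lo..hi} \<Longrightarrow> measure (law F t) UNIV = 1"
  using prob_space.prob_space[OF prob_space_law, of t] by (simp only: space_law)

lemma integral_law_const:
  assumes "t \<in> {lo..hi}"
  shows "(\<integral>y. c \<partial>law F t) = (c :: real)"
  by (simp only: lebesgue_integral_const space_law measure_law_UNIV[OF assms] scaleR_one)

lemma mean_law:
  assumes "t \<in> {lo..hi}"
  shows "integrable (law F t) (\<lambda>y. y)" "(\<integral>y. y \<partial>law F t) = t"
  using A1 assms params_eq by (simp_all add: cond_A1_def)

lemma integral_law_affine:
  assumes "t \<in> {lo..hi}"
  shows "(\<integral>y. y * c - d \<partial>law F t) = t * c - d"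
proof -
  interpret prob_space "law F t" by (rule prob_space_law[OF assms])
  have "(\<integral>y. y * c - d \<partial>law F t) = (\<integral>y. y * c \<partial>law F t) - (\<integral>y. d \<partial>law F t)"
    by (intro Bochner_Integration.integral_diff integrable_mult_left mean_law(1)[OF assms]
        integrable_const)
  also have "\<dots> = t * c - d"
    by (simp only: integral_mult_left_zero mean_law(2)[OF assms] lebesgue_integral_const
        space_law measure_law_UNIV[OF assms] scaleR_one)
  finally show ?thesis .
qed

lemma AE_base_dens_pos: "AE y in law F t. 0 < base_dens F y"
proof -
  have "(\<lambda>y. ennreal (dens F y t)) \<in> borel_measurable (dominating F)"
    by (simp add: measurable_cong_sets[OF sets_dominating refl])
  moreover have "0 < base_dens F y" if "0 < ennreal (dens F y t)" for y
    using that base_dens_nonneg[of y] by (cases "base_dens F y = 0") (auto simp: dens_def)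
  ultimately show ?thesis
    unfolding law_def by (subst AE_density) auto
qed

text \<open>The likelihood ratio of the law at \<open>t\<close> to the law at \<open>s\<close> with
  the base density cancelled. It is positive at every \<open>y\<close>, also where both densities
  vanish.\<close>

definition ratio :: "real \<Rightarrow> real \<Rightarrow> real \<Rightarrow> real" where
  "ratio s t y = exp (y * (comp_C F t - comp_C F s) - (comp_B F t - comp_B F s))"

lemma ratio_measurable [measurable]: "ratio s t \<in> borel_measurable borel"
  unfolding ratio_def by measurable

lemma ratio_pos: "0 < ratio s t y"
  by (simp add: ratio_def)

lemma dens_mult_ratio: "dens F y s * ratio s t y = dens F y t"
  by (simp add: dens_def ratio_def algebra_simps flip: exp_add)

lemma dens_div: "0 < base_dens F y \<Longrightarrow> dens F y t / dens F y s = ratio s t y"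
  by (simp add: dens_def ratio_def algebra_simps flip: exp_diff)

lemma law_eq_density: "law F t = density (law F s) (\<lambda>y. ennreal (ratio s t y))"
proof -
  have [measurable]: "(\<lambda>y. ennreal (dens F y r)) \<in> borel_measurable (dominating F)"
    "(\<lambda>y. ennreal (ratio s r y)) \<in> borel_measurable (dominating F)" for r
    by (simp_all add: measurable_cong_sets[OF sets_dominating refl])
  have "ennreal (dens F y s) * ennreal (ratio s t y) = ennreal (dens F y t)" for y
    using base_dens_nonneg[of y] ratio_pos[of s t y] dens_mult_ratio[of y s t]
    by (simp add: dens_def flip: ennreal_mult)
  then show ?thesis
    unfolding law_def by (simp add: density_density_eq)
qed

lemma law_ratio:
  assumes [measurable]: "g \<in> borel_measurable borel"
  shows "integrable (law F t) g \<longleftrightarrow> integrable (law F s) (\<lambda>y. ratio s t y * g y)"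
    and "integral\<^sup>L (law F t) g = (\<integral>y. ratio s t y * g y \<partial>law F s)"
  by (subst law_eq_density[of t s], subst integrable_density integral_density;
      simp add: less_imp_le[OF ratio_pos])+

text \<open>These exponential moments at \<open>s\<close> are the total mass and the mean at
  \<open>t\<close>, so their existence and values come from (A1).\<close>

lemma ratio_integral:
  assumes "t \<in> {lo..hi}"
  shows "integrable (law F s) (ratio s t)" "(\<integral>y. ratio s t y \<partial>law F s) = 1"
    "integrable (law F s) (\<lambda>y. ratio s t y * y)" "(\<integral>y. ratio s t y * y \<partial>law F s) = t"
proof -
  interpret prob_space "law F t" by (rule prob_space_law[OF assms])
  note one = law_ratio[of "\<lambda>_. 1" t s, simplified mult_1_right, OF borel_measurable_const]
  show "integrable (law F s) (ratio s t)"
    unfolding one(1)[symmetric] by (rule integrable_const)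
  show "(\<integral>y. ratio s t y \<partial>law F s) = 1"
    unfolding one(2)[symmetric]
    by (simp only: lebesgue_integral_const space_law measure_law_UNIV[OF assms] scaleR_one)
  show "integrable (law F s) (\<lambda>y. ratio s t y * y)"
    unfolding law_ratio(1)[of "\<lambda>y. y" t s, OF measurable_ident_sets[OF refl], symmetric]
    by (rule mean_law[OF assms])
  show "(\<integral>y. ratio s t y * y \<partial>law F s) = t"
    unfolding law_ratio(2)[of "\<lambda>y. y" t s, OF measurable_ident_sets[OF refl], symmetric]
    by (rule mean_law[OF assms])
qed

section \<open>Kullback-Leibler divergence and the derivative of B\<close>

lemma KL_eq:
  assumes "s \<in> {lo..hi}"
  shows "KL F s t = s * (comp_C F s - comp_C F t) - (comp_B F s - comp_B F t)"
proof -
  have "KL F s t = (\<integral>y. y * (comp_C F s - comp_C F t) - (comp_B F s - comp_B F t) \<partial>law F s)"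
    unfolding KL_def
    by (intro integral_cong_AE AE_mp[OF AE_base_dens_pos AE_I2])
       (auto simp: dens_div ratio_def)
  then show ?thesis
    by (simp only: integral_law_affine[OF assms])
qed

text \<open>Gibbs' inequality, from \<open>1 + v \<le> exp v\<close> for the log-likelihood ratio
  \<open>v\<close>, and the fact that the ratio integrates to 1.\<close>

lemma KL_nonneg:
  assumes s: "s \<in> {lo..hi}" and t: "t \<in> {lo..hi}"
  shows "0 \<le> KL F s t"
proof -
  interpret prob_space "law F s" by (rule prob_space_law[OF s])
  have "(\<integral>y. 1 - ratio s t y \<partial>law F s)
      \<le> (\<integral>y. y * (comp_C F s - comp_C F t) - (comp_B F s - comp_B F t) \<partial>law F s)"
  proof (rule integral_mono)
    fix y
    have "1 + (y * (comp_C F t - comp_C F s) - (comp_B F t - comp_B F s)) \<le> ratio s t y"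
      unfolding ratio_def by (rule exp_ge_add_one_self)
    then show "1 - ratio s t y
        \<le> y * (comp_C F s - comp_C F t) - (comp_B F s - comp_B F t)"
      by (simp add: algebra_simps)
  qed (use mean_law[OF s] ratio_integral[OF t] in auto)
  moreover have "(\<integral>y. 1 - ratio s t y \<partial>law F s) = 0"
    unfolding Bochner_Integration.integral_diff[OF integrable_const ratio_integral(1)[OF t]]
      ratio_integral(2)[OF t] integral_law_const[OF s] by simp
  ultimately show ?thesis
    by (simp only: integral_law_affine[OF s] KL_eq[OF s])
qed

lemma at_within_not_bot: "t \<in> {lo..hi} \<Longrightarrow> at t within {lo..hi} \<noteq> bot"
  using lo_less_hi by (simp add: islimpt_Icc trivial_limit_within)

text \<open>Nonnegativity of the divergence in both arguments squeezes the difference quotient of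
  \<open>B\<close> between \<open>s\<close> and \<open>t\<close> times that of \<open>C\<close>; no differentiation under the integral is
  needed.\<close>

lemma B'_eq:
  assumes s: "s \<in> {lo..hi}"
  shows "B' s = s * C' s"
proof -
  define q where "q g t = (g t - g s) / (t - s)" for g :: "real \<Rightarrow> real" and t
  let ?F = "at s within {lo..hi}"
  have C: "(q (comp_C F) \<longlongrightarrow> C' s) ?F" and B: "(q (comp_B F) \<longlongrightarrow> B' s) ?F"
    using deriv_C[OF s] deriv_B[OF s] by (simp_all add: has_field_derivative_iff q_def[abs_def])
  have id: "((\<lambda>t. t) \<longlongrightarrow> s) ?F" by (rule tendsto_ident_at)
  have ev: "eventually (\<lambda>t. \<bar>q (comp_B F) t - s * q (comp_C F) t\<bar>
      \<le> \<bar>(t - s) * q (comp_C F) t\<bar>) ?F"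
    unfolding eventually_at_filter
  proof (intro always_eventually allI impI)
    fix t assume t: "t \<noteq> s" "t \<in> {lo..hi}"
    define c b where "c = comp_C F t - comp_C F s" and "b = comp_B F t - comp_B F s"
    have "0 \<le> KL F s t" "0 \<le> KL F t s" using KL_nonneg s t by auto
    then have "0 \<le> b - s * c" "b - s * c \<le> (t - s) * c"
      using s t by (simp_all add: KL_eq c_def b_def algebra_simps)
    then have "\<bar>b - s * c\<bar> / \<bar>t - s\<bar> \<le> \<bar>(t - s) * c\<bar> / \<bar>t - s\<bar>"
      by (intro divide_right_mono) auto
    moreover have "q (comp_B F) t = b / (t - s)" "q (comp_C F) t = c / (t - s)"
      by (simp_all add: q_def b_def c_def)
    then have "q (comp_B F) t - s * q (comp_C F) t = (b - s * c) / (t - s)"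
      "(t - s) * q (comp_C F) t = (t - s) * c / (t - s)"
      by (simp only: diff_divide_distrib times_divide_eq_right, simp only: times_divide_eq_right)
    ultimately show "\<bar>q (comp_B F) t - s * q (comp_C F) t\<bar> \<le> \<bar>(t - s) * q (comp_C F) t\<bar>"
      by (simp only: abs_divide)
  qed
  have "((\<lambda>t. \<bar>(t - s) * q (comp_C F) t\<bar>) \<longlongrightarrow> \<bar>(s - s) * C' s\<bar>) ?F"
    by (intro tendsto_intros C)
  then have "((\<lambda>t. q (comp_B F) t - s * q (comp_C F) t) \<longlongrightarrow> 0) ?F"
    by (intro Lim_null_comparison[OF ev[folded real_norm_def[of "q (comp_B F) _ - _"]]])
       (simp only: diff_self mult_zero_left abs_zero)
  moreover have "((\<lambda>t. q (comp_B F) t - s * q (comp_C F) t) \<longlongrightarrow> B' s - s * C' s) ?F"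
    by (intro tendsto_intros B C)
  ultimately have "0 = B' s - s * C' s"
    by (intro tendsto_unique[OF at_within_not_bot[OF s]])
  then show ?thesis by simp
qed

section \<open>Score, variance and Fisher information\<close>

lemma score:
  assumes s: "s \<in> {lo..hi}" and y: "0 < base_dens F y"
  shows "vector_derivative (\<lambda>t. ln (dens F y t)) (at s within {lo..hi}) = C' s * (y - s)"
proof -
  have "((\<lambda>t. ln (base_dens F y) + (y * comp_C F t - comp_B F t)) has_real_derivative
      y * C' s - B' s) (at s within {lo..hi})"
    using deriv_C[OF s] deriv_B[OF s] by (auto intro!: derivative_eq_intros)
  moreover have "ln (dens F y t) = ln (base_dens F y) + (y * comp_C F t - comp_B F t)" for t
    using y by (simp add: dens_def ln_mult)
  moreover have "y * C' s - B' s = C' s * (y - s)"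
    by (simp add: B'_eq[OF s] algebra_simps)
  ultimately show ?thesis
    using s lo_less_hi
    by (intro vector_derivative_within_closed_interval)
       (auto simp: has_real_derivative_iff_has_vector_derivative)
qed

definition var :: "real \<Rightarrow> real" where
  "var s = (\<integral>y. (y - s)\<^sup>2 \<partial>law F s)"

lemma fisher_info_eq_var:
  assumes s: "s \<in> {lo..hi}"
  shows "fisher_info F s = (C' s)\<^sup>2 * var s"
proof -
  have "(\<integral>y. \<bar>vector_derivative (\<lambda>t. ln (dens F y t)) (at s within params F)\<bar>\<^sup>2 \<partial>law F s)
      = (\<integral>y. (C' s)\<^sup>2 * (y - s)\<^sup>2 \<partial>law F s)"
  proof (rule integral_cong_AE)
    \<comment> \<open>Where the base density is 0, the density is 0 for every parameter and the
      score is the derivative of a constant function. Its value \<open>?c\<close> is the same for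
      all such \<open>y\<close>; this settles measurability, and these points form a null
      set.\<close>
    let ?g = "\<lambda>y. \<bar>vector_derivative (\<lambda>t. ln (dens F y t)) (at s within params F)\<bar>\<^sup>2"
    let ?c = "\<bar>vector_derivative (\<lambda>t::real. 0::real) (at s within params F)\<bar>\<^sup>2"
    have "?g = (\<lambda>y. if 0 < base_dens F y then (C' s * (y - s))\<^sup>2 else ?c)"
    proof (rule ext)
      fix y
      show "?g y = (if 0 < base_dens F y then (C' s * (y - s))\<^sup>2 else ?c)"
      proof (cases "0 < base_dens F y")
        case True
        then show ?thesis by (simp add: params_eq score[OF s])
      next
        case False
        then have "base_dens F y = 0" using base_dens_nonneg[of y] by simp
        then show ?thesis by (simp add: dens_def)
      qed
    qed
    then show "?g \<in> borel_measurable (law F s)"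
      by simp
    show "AE y in law F s. ?g y = (C' s)\<^sup>2 * (y - s)\<^sup>2"
      using AE_base_dens_pos
      by eventually_elim (simp add: params_eq score[OF s] power_mult_distrib)
  qed auto
  then show ?thesis by (simp add: fisher_info_def var_def)
qed

text \<open>Monotonicity makes the difference quotients nonnegative, and the limit cannot be 0,
  since that would make the Fisher information 0.\<close>

lemma C'_pos:
  assumes s: "s \<in> {lo..hi}"
  shows "0 < C' s"
proof -
  have "mono_on {lo..hi} (comp_C F)"
    using A1 by (simp add: cond_A1_def params_eq)
  then have "eventually (\<lambda>t. 0 \<le> (comp_C F t - comp_C F s) / (t - s)) (at s within {lo..hi})"
    unfolding eventually_at_filter
    by (intro always_eventually)
       (use s in \<open>auto simp: mono_on_def zero_le_divide_iff\<close>, meson linorder_linear)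
  then have "0 \<le> C' s"
    using deriv_C[OF s] at_within_not_bot[OF s]
    by (auto simp: has_field_derivative_iff intro: tendsto_lowerbound)
  moreover have "C' s \<noteq> 0"
    using fisher_pos[OF s] fisher_info_eq_var[OF s] by auto
  ultimately show ?thesis by simp
qed

text \<open>A square that is not integrable has Bochner integral 0, which would again make the
  Fisher information 0.\<close>

lemma integrable_square_dev:
  assumes s: "s \<in> {lo..hi}"
  shows "integrable (law F s) (\<lambda>y. (y - s)\<^sup>2)"
proof (rule ccontr)
  assume "\<not> ?thesis"
  then have "var s = 0" by (simp add: var_def not_integrable_integral_eq)
  then show False using fisher_pos[OF s] fisher_info_eq_var[OF s] by simp
qed

section \<open>Quadratic bounds on the divergence\<close>

lemma C_strict_mono:
  assumes "s \<in> {lo..hi}" "t \<in> {lo..hi}" "s < t"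
  shows "comp_C F s < comp_C F t"
proof -
  have "\<exists>r\<in>{s..t}. comp_C F t - comp_C F s = C' r * (t - s)"
    by (rule mvt_very_simple)
       (use assms in \<open>auto intro!: has_derivative_subset[OF deriv_C[unfolded has_field_derivative_def]]\<close>)
  then obtain r where r: "r \<in> {s..t}" "comp_C F t - comp_C F s = C' r * (t - s)" by blast
  then have "0 < C' r * (t - s)" using assms by (intro mult_pos_pos C'_pos) auto
  then show ?thesis using r(2) by simp
qed

lemma C_mono:
  assumes "s \<in> {lo..hi}" "t \<in> {lo..hi}" "s \<le> t"
  shows "comp_C F s \<le> comp_C F t"
  using C_strict_mono[OF assms(1,2)] assms(3) by (cases "s = t") auto

lemma continuous_C: "continuous_on {lo..hi} (comp_C F)"
  and continuous_B: "continuous_on {lo..hi} (comp_B F)"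
  using DERIV_continuous_on[OF deriv_C] DERIV_continuous_on[OF deriv_B] by auto

lemma KL_deriv:
  assumes s: "s \<in> {lo..hi}" and t: "t \<in> {lo..hi}"
  shows "(KL F s has_real_derivative (t - s) * C' t) (at t within {lo..hi})"
  unfolding KL_eq[OF s, abs_def]
  using deriv_C[OF t] deriv_B[OF t] B'_eq[OF t]
  by (auto intro!: derivative_eq_intros simp: algebra_simps)

text \<open>Divergence and parabola both vanish at \<open>s\<close>, and their difference has
  derivative \<open>(r - s) * (C' r - m)\<close>.\<close>

lemma KL_lower:
  assumes s: "s \<in> {lo..hi}" and t: "t \<in> {lo..hi}"
    and m: "\<And>r. r \<in> {lo..hi} \<Longrightarrow> m \<le> C' r"
  shows "m / 2 * (t - s)\<^sup>2 \<le> KL F s t"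
proof -
  have "0 \<le> KL F s t - m / 2 * (t - s)\<^sup>2"
  proof (rule nonneg_of_deriv_sign[where t = t and
        g = "\<lambda>t. KL F s t - m / 2 * (t - s)\<^sup>2" and d = "\<lambda>r. C' r - m" and s = s and a = lo and b = hi])
    fix r assume "r \<in> {lo..hi}"
    then show "((\<lambda>t. KL F s t - m / 2 * (t - s)\<^sup>2) has_real_derivative
        (r - s) * (C' r - m)) (at r within {lo..hi})"
      unfolding right_diff_distrib
      by (intro derivative_intros has_real_derivative_half_square KL_deriv[OF s])
  qed (use s t m KL_self in auto)
  then show ?thesis by simp
qed

lemma KL_upper:
  assumes s: "s \<in> {lo..hi}" and t: "t \<in> {lo..hi}"
    and M: "\<And>r. r \<in> {lo..hi} \<Longrightarrow> C' r \<le> M"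
  shows "KL F s t \<le> M / 2 * (t - s)\<^sup>2"
proof -
  have "0 \<le> M / 2 * (t - s)\<^sup>2 - KL F s t"
  proof (rule nonneg_of_deriv_sign[where t = t and
        g = "\<lambda>t. M / 2 * (t - s)\<^sup>2 - KL F s t" and d = "\<lambda>r. M - C' r" and s = s and a = lo and b = hi])
    fix r assume "r \<in> {lo..hi}"
    then show "((\<lambda>t. M / 2 * (t - s)\<^sup>2 - KL F s t) has_real_derivative
        (r - s) * (M - C' r)) (at r within {lo..hi})"
      unfolding right_diff_distrib
      by (intro derivative_intros has_real_derivative_half_square KL_deriv[OF s])
  qed (use s t M KL_self in auto)
  then show ?thesis by simp
qed

lemma KL_pos:
  assumes s: "s \<in> {lo..hi}" and t: "t \<in> {lo..hi}" and "s \<noteq> t"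
  shows "0 < KL F s t"
proof -
  obtain r where r: "r \<in> {lo..hi}" "\<And>r'. r' \<in> {lo..hi} \<Longrightarrow> C' r \<le> C' r'"
    using continuous_attains_inf[OF _ _ cont_C'] lo_less_hi by auto
  have "0 < C' r / 2 * (t - s)\<^sup>2" using C'_pos[OF r(1)] assms by simp
  also have "\<dots> \<le> KL F s t" by (rule KL_lower[OF s t r(2)])
  finally show ?thesis .
qed

section \<open>The variance as the reciprocal of C'\<close>

text \<open>Centering the exponent at \<open>s\<close> costs exactly the factor
  \<open>exp (KL F s t)\<close>; what remains is the mean at \<open>t\<close> minus
  \<open>s\<close>. Dividing by the increment of \<open>comp_C\<close> and letting \<open>t\<close>
  tend to \<open>s\<close> turns the left side into the variance and the right side into
  \<open>1 / C' s\<close>.\<close>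

lemma centered_ratio_integral:
  assumes s: "s \<in> {lo..hi}" and t: "t \<in> {lo..hi}"
  defines "g \<equiv> \<lambda>y. (y - s) * (exp ((y - s) * (comp_C F t - comp_C F s)) - 1)"
  shows "integrable (law F s) g" "integral\<^sup>L (law F s) g = (t - s) * exp (KL F s t)"
proof -
  have g: "g y = exp (KL F s t) * (ratio s t y * y - s * ratio s t y) - (y * 1 - s)" for y
  proof -
    have "exp ((y - s) * (comp_C F t - comp_C F s)) = exp (KL F s t) * ratio s t y"
      by (simp add: ratio_def KL_eq[OF s] algebra_simps flip: exp_add)
    then show ?thesis by (simp add: g_def algebra_simps)
  qed
  interpret prob_space "law F s" by (rule prob_space_law[OF s])
  note I = ratio_integral[OF t, of s] mean_law[OF s]
  have i1: "integrable (law F s) (\<lambda>y. exp (KL F s t) * (ratio s t y * y - s * ratio s t y))"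
    and i2: "integrable (law F s) (\<lambda>y. y * 1 - s)"
    using I by auto
  then show "integrable (law F s) g"
    unfolding g by (rule Bochner_Integration.integrable_diff)
  have "integral\<^sup>L (law F s) g =
      exp (KL F s t) * (\<integral>y. ratio s t y * y - s * ratio s t y \<partial>law F s) - (s * 1 - s)"
    unfolding g Bochner_Integration.integral_diff[OF i1 i2] integral_law_affine[OF s] by simp
  also have "(\<integral>y. ratio s t y * y - s * ratio s t y \<partial>law F s) = t - s"
    using I by (subst Bochner_Integration.integral_diff) auto
  finally show "integral\<^sup>L (law F s) g = (t - s) * exp (KL F s t)" by simp
qed

text \<open>Differentiating the mean in the parameter. Only one-sided approximation is available at an
  endpoint, where exponential moments may fail to exist on one side; convexity of the exponential
  still dominates the difference quotients by the first of them plus the square.\<close>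

lemma var_mult_C':
  assumes s: "s \<in> {lo..hi}"
  shows "var s * C' s = 1"
proof -
  obtain t0 where t0: "t0 \<in> {lo..hi}" "t0 \<noteq> s"
    using s lo_less_hi by (metis atLeastAtMost_iff less_irrefl order_refl less_imp_le)
  \<comment> \<open>A sequence, so that dominated convergence applies. It moves along the segment
    from \<open>t0\<close> to \<open>s\<close>, hence stays in the interval and on one side of
    \<open>s\<close>, and its first member \<open>t0\<close> gives the largest increment of
    \<open>comp_C\<close>.\<close>
  define t where "t j = s + (t0 - s) / real (Suc j)" for j
  have t: "t j \<in> {lo..hi}" "t j \<noteq> s" for j
  proof -
    have "t j = (1 - 1 / real (Suc j)) * s + (1 / real (Suc j)) * t0"
      by (simp add: t_def diff_divide_distrib algebra_simps)
    then show "t j \<in> {lo..hi}"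
      using convexD_alt[OF convex_real_interval(5) s t0(1), of "1 / real (Suc j)"] by simp
    show "t j \<noteq> s" using t0 by (simp add: t_def)
  qed
  have t_0: "t 0 = t0" by (simp add: t_def)
  have "(\<lambda>j. inverse (real (Suc j))) \<longlonglongrightarrow> 0" by (rule LIMSEQ_inverse_real_of_nat)
  then have "(\<lambda>j. s + (t0 - s) * inverse (real (Suc j))) \<longlonglongrightarrow> s + (t0 - s) * 0"
    by (intro tendsto_intros)
  then have t_lim: "filterlim t (at s within {lo..hi}) sequentially"
    using t by (simp add: filterlim_at t_def[abs_def] divide_inverse)
  define h where "h j = comp_C F (t j) - comp_C F s" for j
  have h0: "h j \<noteq> 0" for j
    using C_strict_mono[OF s t(1), of j] C_strict_mono[OF t(1) s, of j] t(2)[of j]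
    by (fastforce simp: h_def)
  have hk: "0 < h j / h 0" "h j / h 0 \<le> 1" for j
  proof -
    consider "s < t0" | "t0 < s" using t0 by linarith
    then have "0 < h j / h 0 \<and> h j / h 0 \<le> 1"
    proof cases
      case 1
      then have "s < t j" "t j \<le> t0"
        using mult_left_le[of "1 / real (Suc j)" "t0 - s"] by (auto simp: t_def)
      then have "0 < h j" "h j \<le> h 0"
        using C_strict_mono[OF s t(1), of j] C_mono[OF t(1) t0(1), of j] by (auto simp: h_def t_0)
      then show ?thesis by simp
    next
      case 2
      then have "t j < s" "t0 \<le> t j"
        using mult_left_le[of "1 / real (Suc j)" "s - t0"] minus_divide_left[of "s - t0" "real (Suc j)"]
        by (auto simp: t_def divide_neg_pos)
      then have "h j < 0" "h 0 \<le> h j"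
        using C_strict_mono[OF t(1) s, of j] C_mono[OF t0(1) t(1), of j] by (auto simp: h_def t_0)
      then show ?thesis by (simp add: divide_neg_neg divide_le_eq_1)
    qed
    then show "0 < h j / h 0" "h j / h 0 \<le> 1" by auto
  qed
  have C_quot: "((\<lambda>x. (comp_C F x - comp_C F s) / (x - s)) \<longlongrightarrow> C' s) (at s within {lo..hi})"
    using deriv_C[OF s] by (simp add: has_field_derivative_iff)
  then have quot: "(\<lambda>j. h j / (t j - s)) \<longlonglongrightarrow> C' s"
    unfolding h_def by (rule filterlim_compose[OF _ t_lim])
  have h_lim: "h \<longlonglongrightarrow> 0"
  proof -
    have "(comp_C F \<longlongrightarrow> comp_C F s) (at s within {lo..hi})"
      using continuous_C s by (simp add: continuous_on_def)
    then have "(\<lambda>j. comp_C F (t j) - comp_C F s) \<longlonglongrightarrow> comp_C F s - comp_C F s"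
      by (intro tendsto_intros filterlim_compose[OF _ t_lim])
    then show ?thesis by (simp add: h_def[abs_def])
  qed
  have KL_lim: "(\<lambda>j. KL F s (t j)) \<longlonglongrightarrow> 0"
  proof -
    have "continuous_on {lo..hi} (KL F s)"
      using DERIV_continuous_on[OF KL_deriv[OF s]] .
    then have "(KL F s \<longlongrightarrow> KL F s s) (at s within {lo..hi})"
      using s by (simp add: continuous_on_def)
    then show ?thesis
      using filterlim_compose[OF _ t_lim] KL_self by force
  qed
  \<comment> \<open>Tends to \<open>(y - s)\<^sup>2\<close> at each \<open>y\<close>, while its
    integral is known in closed form.\<close>
  define g where "g j y = (y - s) * (exp ((y - s) * h j) - 1) / h j" for j y
  have g: "integrable (law F s) (g j)"
    "integral\<^sup>L (law F s) (g j) = exp (KL F s (t j)) / (h j / (t j - s))" for j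
  proof -
    note I = centered_ratio_integral[OF s t(1)[of j], folded h_def]
    show "integrable (law F s) (g j)"
      unfolding g_def[abs_def] using I(1) by (rule integrable_divide)
    show "integral\<^sup>L (law F s) (g j) = exp (KL F s (t j)) / (h j / (t j - s))"
      unfolding g_def[abs_def] integral_divide_zero I(2) by simp
  qed
  have "(\<lambda>j. integral\<^sup>L (law F s) (g j)) \<longlonglongrightarrow> (\<integral>y. (y - s)\<^sup>2 \<partial>law F s)"
  proof (rule integral_dominated_convergence[where w = "\<lambda>y. (y - s)\<^sup>2 + g 0 y"])
    show "integrable (law F s) (\<lambda>y. (y - s)\<^sup>2 + g 0 y)"
      using integrable_square_dev[OF s] g(1) by (rule Bochner_Integration.integrable_add)
    show "AE y in law F s. (\<lambda>j. g j y) \<longlonglongrightarrow> (y - s)\<^sup>2"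
    proof (rule AE_I2)
      fix y
      have "((\<lambda>x. exp ((y - s) * x)) has_real_derivative (y - s)) (at 0)"
        by (auto intro!: derivative_eq_intros)
      then have "((\<lambda>x. (exp ((y - s) * x) - 1) / x) \<longlongrightarrow> y - s) (at 0)"
        by (simp add: has_field_derivative_iff)
      moreover have "filterlim h (at 0) sequentially"
        using h_lim h0 by (simp add: filterlim_at)
      ultimately have "(\<lambda>j. (exp ((y - s) * h j) - 1) / h j) \<longlonglongrightarrow> y - s"
        by (rule filterlim_compose)
      then have "(\<lambda>j. (y - s) * ((exp ((y - s) * h j) - 1) / h j)) \<longlonglongrightarrow> (y - s) * (y - s)"
        by (intro tendsto_intros)
      then show "(\<lambda>j. g j y) \<longlonglongrightarrow> (y - s)\<^sup>2"
        by (simp add: g_def power2_eq_square)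
    qed
    show "AE y in law F s. norm (g j y) \<le> (y - s)\<^sup>2 + g 0 y" for j
      using abs_mult_expm1_div_le[OF h0 hk] by (intro AE_I2) (simp add: g_def)
    show "g j \<in> borel_measurable (law F s)" for j
      unfolding g_def by measurable
  qed simp
  then have "(\<lambda>j. exp (KL F s (t j)) / (h j / (t j - s))) \<longlonglongrightarrow> var s"
    unfolding g(2) var_def .
  moreover have "(\<lambda>j. exp (KL F s (t j)) / (h j / (t j - s))) \<longlonglongrightarrow> exp 0 / C' s"
    using C'_pos[OF s] by (intro tendsto_intros KL_lim quot) auto
  ultimately have "var s = exp 0 / C' s" by (rule LIMSEQ_unique)
  then show ?thesis using C'_pos[OF s] by simp
qed

lemma fisher_info_eq: "s \<in> {lo..hi} \<Longrightarrow> fisher_info F s = C' s"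
  using var_mult_C'[of s] by (simp add: fisher_info_eq_var power2_eq_square mult.commute)

subsection \<open>Local likelihood estimates\<close>

definition clip :: "real \<Rightarrow> real" where
  "clip x = max lo (min hi x)"

lemma clip_in: "clip x \<in> {lo..hi}"
  using lo_less_hi by (simp add: clip_def)

lemma clip_eq: "x \<in> {lo..hi} \<Longrightarrow> clip x = x"
  by (simp add: clip_def)

lemma abs_clip_diff_le: "t \<in> {lo..hi} \<Longrightarrow> \<bar>clip x - t\<bar> \<le> \<bar>x - t\<bar>"
  by (auto simp: clip_def max_def min_def)

lemma clip_measurable [measurable]: "clip \<in> borel_measurable borel"
  unfolding clip_def[abs_def] by measurable

text \<open>\<open>comp_B\<close> and \<open>comp_C\<close> are arbitrary outside the interval.
  Composition with the projection extends them continuously to the whole line.\<close>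

lemma measurable_comp_clip:
  assumes "continuous_on {lo..hi} g"
  shows "(\<lambda>x. g (clip x) :: real) \<in> borel_measurable borel"
proof -
  have "continuous_on UNIV clip"
    unfolding clip_def[abs_def] by (intro continuous_intros)
  then have "continuous_on UNIV (\<lambda>x. g (clip x))"
    using assms clip_in by (auto intro: continuous_on_compose2)
  then show ?thesis by (rule borel_measurable_continuous_onI)
qed

lemma KL_measurable:
  assumes g: "g \<in> borel_measurable M" "\<And>x. x \<in> space M \<Longrightarrow> g x \<in> {lo..hi}"
    and h: "h \<in> borel_measurable M" "\<And>x. x \<in> space M \<Longrightarrow> h x \<in> {lo..hi}"
  shows "(\<lambda>x. KL F (g x) (h x)) \<in> borel_measurable M"
proof -
  note [measurable] = g(1) h(1) measurable_comp_clip[OF continuous_C] measurable_comp_clip[OF continuous_B]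
  have "(\<lambda>x. g x * (comp_C F (clip (g x)) - comp_C F (clip (h x)))
      - (comp_B F (clip (g x)) - comp_B F (clip (h x)))) \<in> borel_measurable M"
    by measurable
  then show ?thesis
    by (rule measurable_cong[THEN iffD1, rotated]) (simp add: KL_eq[OF g(2)] clip_eq[OF g(2)] clip_eq[OF h(2)])
qed

text \<open>With \<open>x = T / A\<close> and \<open>c = clip x\<close>, the gap between the two
  sides is \<open>A * (KL F c t + (x - c) * (comp_C F c - comp_C F t))\<close>. The divergence is
  positive. The correction is nonnegative: \<open>x\<close> differs from \<open>c\<close> only if
  \<open>c\<close> is the endpoint nearest to \<open>x\<close>, and then monotonicity of
  \<open>comp_C\<close> fixes the sign.\<close>

lemma log_likelihood_less:
  assumes A: "0 < A" and t: "t \<in> {lo..hi}" "t \<noteq> clip (T / A)"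
  shows "T * comp_C F t - A * comp_B F t
       < T * comp_C F (clip (T / A)) - A * comp_B F (clip (T / A))"
proof -
  define x c where "x = T / A" and "c = clip x"
  have c: "c \<in> {lo..hi}" unfolding c_def by (rule clip_in)
  have "0 \<le> (x - c) * (comp_C F c - comp_C F t)"
  proof -
    consider "x = c" | "c < x" "c = hi" | "x < c" "c = lo"
      using lo_less_hi unfolding c_def clip_def max_def min_def by (cases "lo \<le> x"; cases "hi \<le> x"; force)
    then show ?thesis
    proof cases
      case 2
      then show ?thesis using C_mono[OF t(1) c] t(1) by auto
    next
      case 3
      then show ?thesis using C_mono[OF c t(1)] t(1) by (auto intro: mult_nonpos_nonpos)
    qed simp
  qed
  moreover have "0 < KL F c t" using t by (intro KL_pos c) (auto simp: c_def x_def)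
  ultimately have "0 < A * (KL F c t + (x - c) * (comp_C F c - comp_C F t))"
    using A by simp
  also have "\<dots> = (A * x) * (comp_C F c - comp_C F t) - A * (comp_B F c - comp_B F t)"
    by (simp add: KL_eq[OF c] algebra_simps)
  also have "A * x = T" using A by (simp add: x_def)
  finally show ?thesis by (simp add: c_def x_def algebra_simps)
qed

text \<open>An observation with \<open>base_dens F y = 0\<close> contributes \<open>ln 0 = 0\<close> to the likelihood. Leaving such
  observations out describes the maximizer at every sample point, not just almost surely, which
  is what makes it measurable.\<close>

definition eff_weight :: "nat \<Rightarrow> (nat \<Rightarrow> real) \<Rightarrow> (nat \<Rightarrow> real) \<Rightarrow> real" where
  "eff_weight n W y = (\<Sum>i=1..n. if 0 < base_dens F (y i) then W i else 0)"

definition eff_sum :: "nat \<Rightarrow> (nat \<Rightarrow> real) \<Rightarrow> (nat \<Rightarrow> real) \<Rightarrow> real" where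
  "eff_sum n W y = (\<Sum>i=1..n. if 0 < base_dens F (y i) then W i * y i else 0)"

text \<open>If the effective weight is 0, the objective is identically 0. The choice operator then
  returns one fixed point that does not depend on \<open>y\<close>, so this branch is harmless for
  measurability.\<close>

lemma local_mle_eq:
  assumes W: "\<And>i. i \<in> {1..n} \<Longrightarrow> 0 \<le> W i"
  shows "local_mle F n W y =
    (if eff_weight n W y = 0 then ARG_MAX (\<lambda>_. 0 :: real) t. t \<in> {lo..hi}
     else clip (eff_sum n W y / eff_weight n W y))"
proof -
  define A T where "A = eff_weight n W y" and "T = eff_sum n W y"
  define D where "D = (\<Sum>i=1..n. if 0 < base_dens F (y i) then W i * ln (base_dens F (y i)) else 0)"
  have "W i * ln (dens F (y i) t) =
      (if 0 < base_dens F (y i) then W i * ln (base_dens F (y i)) else 0)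
      + (if 0 < base_dens F (y i) then W i * y i else 0) * comp_C F t
      - (if 0 < base_dens F (y i) then W i else 0) * comp_B F t" for i t
    using base_dens_nonneg[of "y i"]
    by (cases "base_dens F (y i) = 0") (auto simp: dens_def ln_mult algebra_simps)
  then have "(\<Sum>i=1..n. W i * ln (dens F (y i) t)) = D + T * comp_C F t - A * comp_B F t" for t
    unfolding D_def T_def A_def eff_sum_def eff_weight_def sum_distrib_right
      sum.distrib[symmetric] sum_subtractf[symmetric]
    by (intro sum.cong refl)
  then have obj: "(\<lambda>t. \<Sum>i=1..n. W i * ln (dens F (y i) t)) =
      (\<lambda>t. D + (T * comp_C F t - A * comp_B F t))"
    by (simp add: fun_eq_iff)
  have nonneg: "0 \<le> A"
    unfolding A_def eff_weight_def by (intro sum_nonneg) (auto simp: W)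
  show ?thesis
  proof (cases "A = 0")
    case True
    then have "\<forall>i\<in>{1..n}. (if 0 < base_dens F (y i) then W i else 0) = 0"
      unfolding A_def eff_weight_def
      by (subst (asm) sum_nonneg_eq_0_iff) (use W in auto)
    then have *: "i \<in> {1..n} \<Longrightarrow> 0 < base_dens F (y i) \<Longrightarrow> W i = 0" for i
      by metis
    have "D = 0" "T = 0"
      unfolding D_def T_def eff_sum_def by (intro sum.neutral; simp add: *)+
    with True show ?thesis
      unfolding local_mle_def obj by (simp add: params_eq A_def)
  next
    case False
    then have A: "0 < A" using nonneg by simp
    have "arg_max (\<lambda>t. D + (T * comp_C F t - A * comp_B F t)) (\<lambda>t. t \<in> params F) = clip (T / A)"
      unfolding arg_max_def
    proof (rule some_equality)
      show "is_arg_max (\<lambda>t. D + (T * comp_C F t - A * comp_B F t)) (\<lambda>t. t \<in> params F) (clip (T / A))"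
        unfolding is_arg_max_def params_eq
        using log_likelihood_less[OF A, where T = T] clip_in
        by (metis add_less_cancel_left less_asym)
    next
      fix t assume "is_arg_max (\<lambda>t. D + (T * comp_C F t - A * comp_B F t)) (\<lambda>t. t \<in> params F) t"
      then show "t = clip (T / A)"
        unfolding is_arg_max_def params_eq
        using log_likelihood_less[OF A, where T = T] clip_in
        by (metis add_less_cancel_left)
    qed
    then show ?thesis
      using False unfolding local_mle_def obj by (simp add: A_def T_def)
  qed
qed

lemma local_mle_in:
  assumes "\<And>i. i \<in> {1..n} \<Longrightarrow> 0 \<le> W i"
  shows "local_mle F n W y \<in> {lo..hi}"
proof -
  \<comment> \<open>\<open>lo\<close> only witnesses that a maximizer exists, so that the chosen one
    lies in the interval.\<close>
  have "is_arg_max (\<lambda>_. 0 :: real) (\<lambda>t. t \<in> {lo..hi}) lo"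
    using lo_less_hi by (simp add: is_arg_max_def)
  then have "is_arg_max (\<lambda>_. 0 :: real) (\<lambda>t. t \<in> {lo..hi}) (ARG_MAX (\<lambda>_. 0 :: real) t. t \<in> {lo..hi})"
    unfolding arg_max_def by (rule someI)
  then show ?thesis
    by (subst local_mle_eq[of n W y, OF assms]) (use clip_in in \<open>auto simp only: is_arg_max_def split: if_split\<close>)
qed

text \<open>The index set \<open>I\<close> is kept free because the estimate is needed both on the
  full sample space and on the product over the support of the weights.\<close>

lemma local_mle_measurable:
  assumes W: "\<And>i. i \<in> {1..n} \<Longrightarrow> 0 \<le> W i"
    and I: "\<And>i. i \<in> {1..n} \<Longrightarrow> W i \<noteq> 0 \<Longrightarrow> i \<in> I"
  shows "local_mle F n W \<in> borel_measurable (PiM I (\<lambda>_. borel))"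
proof -
  have "(\<lambda>y. if 0 < base_dens F (y i) then W i else 0) \<in> borel_measurable (PiM I (\<lambda>_. borel))"
    "(\<lambda>y. if 0 < base_dens F (y i) then W i * y i else 0) \<in> borel_measurable (PiM I (\<lambda>_. borel))"
    if i: "i \<in> {1..n}" for i
  proof -
    consider "i \<in> I" | "W i = 0" using I[OF i] by blast
    then have "(\<lambda>y. if 0 < base_dens F (y i) then W i else 0) \<in> borel_measurable (PiM I (\<lambda>_. borel)) \<and>
      (\<lambda>y. if 0 < base_dens F (y i) then W i * y i else 0) \<in> borel_measurable (PiM I (\<lambda>_. borel))"
    proof cases
      case 1
      then have [measurable]: "(\<lambda>y. y i) \<in> borel_measurable (PiM I (\<lambda>_. borel :: real measure))"
        by (rule measurable_component_singleton)
      show ?thesis by measurable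
    next
      case 2
      show ?thesis by (simp add: 2 cong: if_cong)
    qed
    then show "(\<lambda>y. if 0 < base_dens F (y i) then W i else 0) \<in> borel_measurable (PiM I (\<lambda>_. borel))"
      "(\<lambda>y. if 0 < base_dens F (y i) then W i * y i else 0) \<in> borel_measurable (PiM I (\<lambda>_. borel))"
      by auto
  qed
  then have [measurable]: "eff_weight n W \<in> borel_measurable (PiM I (\<lambda>_. borel))"
    "eff_sum n W \<in> borel_measurable (PiM I (\<lambda>_. borel))"
    unfolding eff_weight_def[abs_def] eff_sum_def[abs_def] by (auto intro!: borel_measurable_sum)
  show ?thesis
    by (subst measurable_cong[OF local_mle_eq[of n W, OF W]]) measurable
qed

end

section \<open>Aggregation\<close>

lemma local_mle_cong:
  assumes "\<And>i. i \<in> {1..n} \<Longrightarrow> W i \<noteq> 0 \<Longrightarrow> y i = y' i"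
  shows "local_mle F n W y = local_mle F n W y'"
proof -
  have "(\<Sum>i=1..n. W i * ln (dens F (y i) t)) = (\<Sum>i=1..n. W i * ln (dens F (y' i) t))" for t
  proof (rule sum.cong)
    fix i assume "i \<in> {1..n}"
    then show "W i * ln (dens F (y i) t) = W i * ln (dens F (y' i) t)"
      using assms[of i] by (cases "W i = 0") simp_all
  qed simp
  then show ?thesis by (simp add: local_mle_def)
qed

text \<open>Monotone functions are Borel. The kernel is controlled only on nonnegative arguments, so
  \<open>max 0\<close> extends it to the line, and the sign makes it increasing.\<close>

lemma aggregation_kernel_measurable:
  assumes "aggregation_kernel Kag b"
    and g [measurable]: "g \<in> borel_measurable M" and "\<And>x. x \<in> space M \<Longrightarrow> 0 \<le> g x"
  shows "(\<lambda>x. Kag (g x)) \<in> borel_measurable M"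
proof -
  have "mono (\<lambda>t. - Kag (max 0 t))"
    using assms(1) by (auto simp: aggregation_kernel_def monotone_on_def)
  then have "(\<lambda>t. - Kag (max 0 t)) \<in> borel_measurable borel"
    by (rule borel_measurable_mono)
  then have [measurable]: "(\<lambda>t. Kag (max 0 t)) \<in> borel_measurable borel"
    by simp
  have "(\<lambda>x. Kag (max 0 (g x))) \<in> borel_measurable M"
    by (rule measurable_compose[OF g]) measurable
  then show ?thesis
    by (rule measurable_cong[THEN iffD1, rotated]) (simp add: assms(3) max_absorb2)
qed

locale aggregation = exponential_family F lo hi C' B'
  for F :: expfam and lo hi :: real and C' B' :: "real \<Rightarrow> real" +
  fixes n K :: nat and w :: "nat \<Rightarrow> nat \<Rightarrow> real" and Kag :: "real \<Rightarrow> real"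
    and z :: "nat \<Rightarrow> real" and u0 u b :: real
  assumes schemes: "localizing_schemes n K w" and A3: "cond_A3 n K w u0 u"
    and kernel: "aggregation_kernel Kag b"
    and z_pos: "\<And>k. k \<in> {1..K} \<Longrightarrow> 0 < z k"
begin

abbreviation N :: "nat \<Rightarrow> real" where "N k \<equiv> local_size n (w k)"

abbreviation mle :: "nat \<Rightarrow> (nat \<Rightarrow> real) \<Rightarrow> real" where "mle k y \<equiv> local_mle F n (w k) y"

abbreviation agg :: "nat \<Rightarrow> (nat \<Rightarrow> real) \<Rightarrow> real" where "agg k y \<equiv> aggregate F n w Kag z y k"

lemma N_pos: "k \<in> {1..K} \<Longrightarrow> 0 < N k"
  using schemes by (simp add: localizing_schemes_def)

lemma w_bounds: "k \<in> {1..K} \<Longrightarrow> i \<in> {1..n} \<Longrightarrow> 0 \<le> w k i \<and> w k i \<le> 1"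
  using schemes by (simp add: localizing_schemes_def)

lemma w_support_mono:
  assumes "k \<in> {1..K}" "j \<in> {1..k}" "i \<in> {1..n}" "w j i \<noteq> 0"
  shows "0 < w k i"
proof -
  have "w j i \<le> w k i"
    using assms A3 by (cases "j = k") (auto simp: cond_A3_def)
  moreover have "0 < w j i" using w_bounds[of j i] assms by auto
  ultimately show ?thesis by simp
qed

lemma mle_in: "k \<in> {1..K} \<Longrightarrow> mle k y \<in> {lo..hi}"
  using w_bounds by (intro local_mle_in) auto

declare aggregate.simps(2) [simp del]

lemma agg_1: "agg 1 y = mle 1 y"
  by (simp add: aggregate.simps(2))

text \<open>Shifted by one: \<open>gam k\<close> is the aggregation weight of step
  \<open>k + 1\<close>, where the estimate of step \<open>k\<close> is the previous one.\<close>

definition gam :: "nat \<Rightarrow> (nat \<Rightarrow> real) \<Rightarrow> real" where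
  "gam k y = Kag (N (Suc k) * KL F (mle (Suc k) y) (agg k y) / z (Suc k))"

lemma agg_Suc:
  assumes "1 \<le> k"
  shows "agg (Suc k) y = gam k y * mle (Suc k) y + (1 - gam k y) * agg k y"
  using assms by (simp add: aggregate.simps(2) Let_def gam_def)

lemma gam_bounds:
  assumes "1 \<le> k" "Suc k \<le> K" "agg k y \<in> {lo..hi}"
  shows "0 \<le> N (Suc k) * KL F (mle (Suc k) y) (agg k y) / z (Suc k)" "gam k y \<in> {0..1}"
proof -
  show "0 \<le> N (Suc k) * KL F (mle (Suc k) y) (agg k y) / z (Suc k)"
    using assms N_pos[of "Suc k"] z_pos[of "Suc k"] KL_nonneg[OF mle_in[of "Suc k" y] assms(3)]
    by (simp add: less_imp_le)
  then show "gam k y \<in> {0..1}"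
    using kernel by (auto simp: gam_def aggregation_kernel_def)
qed

lemma agg_in:
  assumes "k \<in> {1..K}"
  shows "agg k y \<in> {lo..hi}"
proof -
  have "1 \<le> k" using assms by simp
  then have "k \<le> K \<longrightarrow> agg k y \<in> {lo..hi}"
  proof (induction k rule: dec_induct)
    case base
    then show ?case using mle_in[of 1 y] by (simp only: agg_1) simp
  next
    case (step k)
    show ?case
    proof
      assume k: "Suc k \<le> K"
      then have a: "agg k y \<in> {lo..hi}" using step by simp
      have "(1 - gam k y) *\<^sub>R agg k y + gam k y *\<^sub>R mle (Suc k) y \<in> {lo..hi}"
        using gam_bounds(2)[OF step.hyps(1) k a] k
        by (intro convexD_alt[OF convex_real_interval(5) a mle_in]) auto
      then show "agg (Suc k) y \<in> {lo..hi}"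
        by (simp only: agg_Suc[OF step.hyps(1)] real_scaleR_def add.commute)
    qed
  qed
  then show ?thesis using assms by simp
qed

lemma mle_measurable:
  assumes "k \<in> {1..K}" "\<And>i. i \<in> {1..n} \<Longrightarrow> 0 < w k i \<Longrightarrow> i \<in> I"
  shows "mle k \<in> borel_measurable (PiM I (\<lambda>_. borel))"
  using w_bounds[OF assms(1)] assms(2) by (intro local_mle_measurable) force+

lemma agg_measurable:
  assumes "k \<in> {1..K}" and I: "\<And>i. i \<in> {1..n} \<Longrightarrow> 0 < w k i \<Longrightarrow> i \<in> I"
  shows "agg k \<in> borel_measurable (PiM I (\<lambda>_. borel))"
proof -
  have mle: "mle j \<in> borel_measurable (PiM I (\<lambda>_. borel))" if "j \<in> {1..k}" for j
    using that assms(1) I w_support_mono[OF assms(1) that]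
    by (intro mle_measurable) auto
  have "j \<le> k \<longrightarrow> agg j \<in> borel_measurable (PiM I (\<lambda>_. borel))" if "1 \<le> j" for j
    using that(1)
  proof (induction j rule: dec_induct)
    case base
    then show ?case using mle[of 1] by (auto simp only: agg_1 atLeastAtMost_iff order_refl)
  next
    case (step j)
    show ?case
    proof
      assume j: "Suc j \<le> k"
      then have jK: "j \<in> {1..K}" "Suc j \<in> {1..K}" using assms(1) step.hyps by auto
      have [measurable]: "agg j \<in> borel_measurable (PiM I (\<lambda>_. borel))"
        "mle (Suc j) \<in> borel_measurable (PiM I (\<lambda>_. borel))"
        using step j mle[of "Suc j"] by auto
      have [measurable]: "(\<lambda>y. KL F (mle (Suc j) y) (agg j y)) \<in> borel_measurable (PiM I (\<lambda>_. borel))"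
        using agg_in[OF jK(1)] mle_in[OF jK(2)] by (intro KL_measurable) auto
      have [measurable]: "gam j \<in> borel_measurable (PiM I (\<lambda>_. borel))"
        unfolding gam_def[abs_def]
      proof (rule aggregation_kernel_measurable[OF kernel])
        show "0 \<le> N (Suc j) * KL F (mle (Suc j) y) (agg j y) / z (Suc j)" for y
          using jK by (intro gam_bounds(1) step.hyps agg_in) auto
      qed measurable
      have "(\<lambda>y. gam j y * mle (Suc j) y + (1 - gam j y) * agg j y)
          \<in> borel_measurable (PiM I (\<lambda>_. borel))"
        by measurable
      then show "agg (Suc j) \<in> borel_measurable (PiM I (\<lambda>_. borel))"
        by (simp only: agg_Suc[OF step.hyps(1)])
    qed
  qed
  then show ?thesis using assms(1) by simp
qed

lemma agg_cong:
  assumes "k \<in> {1..K}" and "\<And>i. i \<in> {1..n} \<Longrightarrow> 0 < w k i \<Longrightarrow> y i = y' i"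
  shows "agg k y = agg k y'"
proof -
  have mle: "mle j y = mle j y'" if "j \<in> {1..k}" for j
    using assms(2) w_support_mono[OF assms(1) that] by (intro local_mle_cong) auto
  have "j \<le> k \<longrightarrow> agg j y = agg j y'" if "1 \<le> j" for j
    using that
  proof (induction j rule: dec_induct)
    case base
    then show ?case using mle[of 1] by (simp only: agg_1) simp
  next
    case (step j)
    show ?case
    proof
      assume "Suc j \<le> k"
      then have "agg j y = agg j y'" "mle (Suc j) y = mle (Suc j) y'"
        using step mle[of "Suc j"] by auto
      then show "agg (Suc j) y = agg (Suc j) y'"
        by (simp only: agg_Suc[OF step.hyps(1)] gam_def)
    qed
  qed
  then show ?thesis using assms(1) by simp
qed

section \<open>Stability of the aggregated estimate after step ks\<close>

text \<open>The kernel vanishes beyond 1, so a nonzero weight bounds the divergence of the new weak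
  estimate from the previous aggregate. \<open>KL_lower\<close> turns this into a bound on their
  distance, and the convex combination covers only a part of that distance.\<close>

lemma agg_step:
  assumes k: "1 \<le> k" "Suc k \<le> K" and m: "0 < m" "\<And>r. r \<in> {lo..hi} \<Longrightarrow> m \<le> C' r"
  shows "sqrt (m / 2) * \<bar>agg (Suc k) y - agg k y\<bar> \<le> sqrt (z (Suc k) / N (Suc k))"
proof -
  define \<theta> t where "\<theta> = mle (Suc k) y" and "t = agg k y"
  have in': "\<theta> \<in> {lo..hi}" "t \<in> {lo..hi}" using k agg_in mle_in by (auto simp: \<theta>_def t_def)
  have pos: "0 < N (Suc k)" "0 < z (Suc k)" using k N_pos z_pos by auto
  note \<gamma> = gam_bounds[OF k, of y, OF in'(2)[unfolded t_def]]
  have eq: "\<bar>agg (Suc k) y - agg k y\<bar> = gam k y * \<bar>\<theta> - t\<bar>"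
  proof -
    have "agg (Suc k) y - agg k y = gam k y * (\<theta> - t)"
      by (simp only: agg_Suc[OF k(1)] \<theta>_def t_def) (simp add: algebra_simps)
    then show ?thesis using \<gamma>(2) by (simp add: abs_mult)
  qed
  show ?thesis
  proof (cases "gam k y = 0")
    case True
    then show ?thesis using pos by (simp add: eq)
  next
    case False
    have "\<not> 1 < N (Suc k) * KL F \<theta> t / z (Suc k)"
      using False kernel by (auto simp: gam_def \<theta>_def t_def aggregation_kernel_def)
    then have "KL F \<theta> t \<le> z (Suc k) / N (Suc k)"
      using pos by (simp add: field_simps)
    with KL_lower[OF in' m(2)] have "m / 2 * (\<theta> - t)\<^sup>2 \<le> z (Suc k) / N (Suc k)"
      unfolding power2_commute[of \<theta> t] by linarith
    then have "sqrt (m / 2 * (\<theta> - t)\<^sup>2) \<le> sqrt (z (Suc k) / N (Suc k))"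
      by (rule real_sqrt_le_mono)
    then have "sqrt (m / 2) * \<bar>\<theta> - t\<bar> \<le> sqrt (z (Suc k) / N (Suc k))"
      by (simp only: real_sqrt_mult real_sqrt_abs)
    moreover have "sqrt (m / 2) * (gam k y * \<bar>\<theta> - t\<bar>) \<le> sqrt (m / 2) * \<bar>\<theta> - t\<bar>"
      using \<gamma>(2) m(1) by (intro mult_left_mono mult_left_le_one_le) auto
    ultimately show ?thesis by (simp add: eq)
  qed
qed

lemma N_growth:
  assumes "k \<in> {1..K}" "k + j \<le> K"
  shows "N k \<le> u ^ j * N (k + j)"
  using assms(2)
proof (induction j)
  case (Suc j)
  have "k + Suc j \<in> {2..K}" using Suc.prems assms(1) by auto
  then have "N (k + Suc j - 1) / N (k + Suc j) \<le> u"
    using A3 unfolding cond_A3_def by blast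
  then have "N (k + j) \<le> u * N (k + Suc j)"
    using N_pos[of "k + Suc j"] Suc.prems by (simp add: divide_le_eq)
  moreover have "0 \<le> u ^ j" using A3 by (simp add: cond_A3_def)
  ultimately have step: "u ^ j * N (k + j) \<le> u ^ j * (u * N (k + Suc j))"
    by (rule mult_left_mono)
  note step
  also have "\<dots> = u ^ Suc j * N (k + Suc j)" by simp
  finally show ?case using Suc.IH Suc.prems by linarith
qed simp

text \<open>With \<open>q = sqrt u\<close>, growth of the local sizes makes the \<open>j\<close>-th
  step after \<open>ks\<close>, in the scale of the statement, at most
  \<open>sqrt Z * q ^ j\<close>. The sum starts at \<open>j = 1\<close>, so the series is
  \<open>q / (1 - q) = inverse (inverse q - 1)\<close>, which is the constant c_u.\<close>

lemma agg_stability: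
  assumes ks: "ks \<in> {1..K}" and m: "0 < m" "\<And>r. r \<in> {lo..hi} \<Longrightarrow> m \<le> C' r"
    and Z: "\<And>k. k \<in> {ks..K} \<Longrightarrow> z k \<le> Z"
  shows "sqrt (m / 2) * (sqrt (N ks) * \<bar>agg K y - agg ks y\<bar>)
       \<le> inverse (u powr (-1/2) - 1) * sqrt Z"
proof -
  have u: "0 < u" "u < 1" using A3 by (auto simp: cond_A3_def)
  define q where "q = sqrt u"
  have q: "0 < q" "q < 1" using u by (auto simp: q_def)
  have Z0: "0 \<le> Z" using Z[of ks] z_pos[OF ks] ks by simp
  have "ks + j \<le> K \<longrightarrow> sqrt (m / 2) * (sqrt (N ks) * \<bar>agg (ks + j) y - agg ks y\<bar>)
      \<le> sqrt Z * (\<Sum>i=1..j. q ^ i)" for j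
  proof (induction j)
    case (Suc j)
    show ?case
    proof
      assume K: "ks + Suc j \<le> K"
      have pos: "0 < N (ks + Suc j)" "0 < N ks" using N_pos K ks by auto
      have "sqrt (m / 2) * \<bar>agg (Suc (ks + j)) y - agg (ks + j) y\<bar>
          \<le> sqrt (z (Suc (ks + j)) / N (Suc (ks + j)))"
        using ks K by (intro agg_step m) auto
      also have "\<dots> \<le> sqrt (Z / N (Suc (ks + j)))"
        using Z[of "Suc (ks + j)"] K pos by (intro real_sqrt_le_mono divide_right_mono) auto
      finally have "sqrt (N ks) * (sqrt (m / 2) * \<bar>agg (Suc (ks + j)) y - agg (ks + j) y\<bar>)
          \<le> sqrt (N ks) * sqrt (Z / N (ks + Suc j))"
        using pos by (intro mult_left_mono) auto
      also have "\<dots> \<le> sqrt (u ^ Suc j * N (ks + Suc j)) * sqrt (Z / N (ks + Suc j))"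
        using N_growth[OF ks K] pos Z0 by (intro mult_right_mono real_sqrt_le_mono) auto
      also have "\<dots> = sqrt Z * q ^ Suc j"
        using pos by (simp add: q_def real_sqrt_mult real_sqrt_divide real_sqrt_power)
      finally have step: "sqrt (m / 2) * (sqrt (N ks) * \<bar>agg (ks + Suc j) y - agg (ks + j) y\<bar>)
          \<le> sqrt Z * q ^ Suc j"
        by (simp only: add_Suc_right mult.left_commute)
      have "sqrt (m / 2) * (sqrt (N ks) * \<bar>agg (ks + Suc j) y - agg ks y\<bar>)
          \<le> sqrt (m / 2) * (sqrt (N ks) *
              (\<bar>agg (ks + Suc j) y - agg (ks + j) y\<bar> + \<bar>agg (ks + j) y - agg ks y\<bar>))"
        using m(1) pos by (intro mult_left_mono) auto
      also have "\<dots> \<le> sqrt Z * q ^ Suc j + sqrt Z * (\<Sum>i=1..j. q ^ i)"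
        unfolding distrib_left using Suc.IH K step by (intro add_mono) auto
      also have "\<dots> = sqrt Z * (\<Sum>i=1..Suc j. q ^ i)"
        by (simp add: algebra_simps)
      finally show "sqrt (m / 2) * (sqrt (N ks) * \<bar>agg (ks + Suc j) y - agg ks y\<bar>)
          \<le> sqrt Z * (\<Sum>i=1..Suc j. q ^ i)" .
    qed
  qed simp
  from this[of "K - ks"] ks
  have "sqrt (m / 2) * (sqrt (N ks) * \<bar>agg K y - agg ks y\<bar>) \<le> sqrt Z * (\<Sum>i=1..K-ks. q ^ i)"
    by simp
  also have "\<dots> \<le> sqrt Z * inverse (u powr (-1/2) - 1)"
  proof (rule mult_left_mono)
    have "(1 - q) * (\<Sum>i=1..J. q ^ i) = q - q ^ Suc J" for J
    proof (induction J)
      case (Suc J)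
      have "(1 - q) * (\<Sum>i=1..Suc J. q ^ i) = (1 - q) * (\<Sum>i=1..J. q ^ i) + (1 - q) * q ^ Suc J"
        by (simp add: distrib_left)
      also have "\<dots> = q - q ^ Suc J + (1 - q) * q ^ Suc J" by (simp only: Suc.IH)
      also have "\<dots> = q - q ^ Suc (Suc J)" by (simp add: algebra_simps)
      finally show ?case .
    qed simp
    then have "(1 - q) * (\<Sum>i=1..K-ks. q ^ i) \<le> q" using q by simp
    then have "(\<Sum>i=1..K-ks. q ^ i) \<le> q / (1 - q)" using q by (simp add: field_simps)
    also have "q / (1 - q) = inverse (inverse q - 1)" using q by (simp add: field_simps)
    also have "inverse q = u powr (-1/2)"
      using u by (simp add: q_def powr_minus powr_half_sqrt)
    finally show "(\<Sum>i=1..K-ks. q ^ i) \<le> inverse (u powr (-1/2) - 1)" .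
  qed (use Z0 in simp)
  finally show ?thesis by (simp add: mult.commute)
qed

section \<open>Change of measure and risk at step ks\<close>

definition supp :: "nat \<Rightarrow> nat set" where
  "supp k = {i \<in> {1..n}. 0 < w k i}"

lemma sets_PiM_law: "sets (PiM I (\<lambda>i. law F (g i))) = sets (PiM I (\<lambda>_. borel))"
  by (intro sets_PiM_cong) simp_all

lemma measurable_PiM_law:
  "h \<in> borel_measurable (PiM I (\<lambda>_. borel)) \<Longrightarrow> h \<in> borel_measurable (PiM I (\<lambda>i. law F (g i)))"
  using measurable_cong_sets[OF sets_PiM_law refl] by blast

lemma prob_space_joint:
  assumes "\<And>x. f x \<in> {lo..hi}"
  shows "prob_space (joint_law F n X f)"
  unfolding joint_law_def by (intro prob_space_PiM prob_space_law assms)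

text \<open>Almost surely the squared ratio is the integrand of \<open>delta\<close>, so the
  modeling bias is the sum of the logarithms of these factors.\<close>

lemma prod_bias_le:
  assumes f: "\<And>x. f x \<in> {lo..hi}"
    and bias: "modeling_bias F n X f (w k) \<theta> \<le> ereal \<Delta>"
  shows "(\<Prod>i\<in>supp k. \<integral>\<^sup>+y. (ennreal (ratio \<theta> (f (X i)) y))\<^sup>2 \<partial>law F \<theta>) \<le> ennreal (exp \<Delta>)"
proof (rule prod_le_exp_sum_log_ennreal)
  have "(\<integral>\<^sup>+y. (ennreal (ratio \<theta> t y))\<^sup>2 \<partial>law F \<theta>)
      = (\<integral>\<^sup>+y. ennreal ((dens F y t)\<^sup>2 / (dens F y \<theta>)\<^sup>2) \<partial>law F \<theta>)" for t
  proof (rule nn_integral_cong_AE)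
    show "AE y in law F \<theta>. (ennreal (ratio \<theta> t y))\<^sup>2 = ennreal ((dens F y t)\<^sup>2 / (dens F y \<theta>)\<^sup>2)"
      using AE_base_dens_pos
      by eventually_elim
        (simp add: dens_div less_imp_le[OF ratio_pos] ennreal_power flip: power_divide)
  qed
  then have "(\<Sum>i\<in>supp k. log_ennreal (\<integral>\<^sup>+y. (ennreal (ratio \<theta> (f (X i)) y))\<^sup>2 \<partial>law F \<theta>))
      = (\<Sum>i\<in>supp k. delta F \<theta> (f (X i)))"
    by (simp add: delta_def)
  also have "\<dots> = modeling_bias F n X f (w k) \<theta>"
    unfolding modeling_bias_def supp_def by (rule sum.inter_filter) simp
  finally show "(\<Sum>i\<in>supp k. log_ennreal (\<integral>\<^sup>+y. (ennreal (ratio \<theta> (f (X i)) y))\<^sup>2 \<partial>law F \<theta>))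
      \<le> ereal \<Delta>"
    using bias by simp
qed (simp add: supp_def)

text \<open>Measurability is asked over every index set containing the support: the change of
  measure takes place over the support itself, integrability under \<open>f\<close> over all
  observations.\<close>

lemma risk_transfer:
  assumes f: "\<And>x. f x \<in> {lo..hi}" and \<theta>: "\<theta> \<in> {lo..hi}"
    and bias: "modeling_bias F n X f (w k) \<theta> \<le> ereal \<Delta>"
    and h: "\<And>I. supp k \<subseteq> I \<Longrightarrow> h \<in> borel_measurable (PiM I (\<lambda>_. borel))"
    and dep: "\<And>y. h (restrict y (supp k)) = h y"
    and h0: "\<And>y. 0 \<le> h y"
    and h2: "integrable (joint_law F n X (\<lambda>_. \<theta>)) (\<lambda>y. (h y)\<^sup>2)"
    and R: "(\<integral>y. (h y)\<^sup>2 \<partial>joint_law F n X (\<lambda>_. \<theta>)) \<le> R"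
  shows "integrable (joint_law F n X f) h" "(\<integral>y. h y \<partial>joint_law F n X f) \<le> sqrt (R * exp \<Delta>)"
proof -
  let ?P = "\<lambda>i. law F (f (X i))" and ?Q = "\<lambda>_ :: nat. law F \<theta>"
  let ?x = "\<integral>\<^sup>+y. ennreal (h y) \<partial>PiM {1..n} ?P"
  have R0: "0 \<le> R" using R by (rule order_trans[rotated]) simp
  have "?x\<^sup>2 \<le> (\<integral>\<^sup>+y. (ennreal (h y))\<^sup>2 \<partial>PiM {1..n} ?Q)
      * (\<Prod>i\<in>supp k. \<integral>\<^sup>+y. (ennreal (ratio \<theta> (f (X i)) y))\<^sup>2 \<partial>law F \<theta>)"
  proof (rule nn_integral_change_of_measure[where S = "supp k" and
        r = "\<lambda>i y. ennreal (ratio \<theta> (f (X i)) y)"])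
    show "(\<lambda>y. ennreal (h y)) \<in> borel_measurable (PiM (supp k) ?Q)"
      using measurable_PiM_law[OF h[OF order_refl]] by measurable
    show "?P i = density (law F \<theta>) (\<lambda>y. ennreal (ratio \<theta> (f (X i)) y))" for i
      by (rule law_eq_density)
    show "(\<lambda>y. ennreal (ratio \<theta> (f (X i)) y)) \<in> borel_measurable (law F \<theta>)" for i
      by measurable
    show "supp k \<subseteq> {1..n}" by (auto simp: supp_def)
    show "prob_space (?P i)" "prob_space (?Q i)" for i
      by (intro prob_space_law f \<theta>)+
  qed (simp_all only: dep finite_atLeastAtMost)
  also have "(\<integral>\<^sup>+y. (ennreal (h y))\<^sup>2 \<partial>PiM {1..n} ?Q) = ennreal (\<integral>y. (h y)\<^sup>2 \<partial>PiM {1..n} ?Q)"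
    using h2 h0 unfolding joint_law_def
    by (subst nn_integral_eq_integral[symmetric]) (simp_all add: ennreal_power)
  also have "\<dots> * (\<Prod>i\<in>supp k. \<integral>\<^sup>+y. (ennreal (ratio \<theta> (f (X i)) y))\<^sup>2 \<partial>law F \<theta>)
      \<le> ennreal R * ennreal (exp \<Delta>)"
    using R unfolding joint_law_def
    by (intro mult_mono ennreal_leI prod_bias_le f bias) auto
  finally have sq: "?x\<^sup>2 \<le> ennreal (R * exp \<Delta>)"
    using R0 by (simp add: ennreal_mult)
  \<comment> \<open>The second moment under \<theta> bounds the first moment under \<open>f\<close>,
    so integrability is transferred along with the bound.\<close>
  then have fin: "?x < \<infinity>"
    using le_less_trans[OF sq ennreal_less_top] by (simp add: power_less_top_ennreal)
  have meas: "h \<in> borel_measurable (PiM {1..n} ?P)"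
    by (intro measurable_PiM_law h) (auto simp: supp_def)
  then show int: "integrable (joint_law F n X f) h"
    unfolding joint_law_def using fin h0 by (intro integrableI_nonneg) auto
  have "?x = ennreal (\<integral>y. h y \<partial>joint_law F n X f)"
    using int h0 unfolding joint_law_def by (intro nn_integral_eq_integral) auto
  with sq have "ennreal ((\<integral>y. h y \<partial>joint_law F n X f)\<^sup>2) \<le> ennreal (R * exp \<Delta>)"
    using h0 by (simp add: ennreal_power)
  then have "(\<integral>y. h y \<partial>joint_law F n X f)\<^sup>2 \<le> R * exp \<Delta>"
    using R0 by (subst (asm) ennreal_le_iff) auto
  then show "(\<integral>y. h y \<partial>joint_law F n X f) \<le> sqrt (R * exp \<Delta>)"
    by (rule real_le_rsqrt)
qed

text \<open>Projection onto an interval containing \<theta> brings the weighted mean no farther from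
  \<theta>, and the variance of that mean is a sum over independent observations.\<close>

lemma mle_risk:
  assumes k: "k \<in> {1..K}" and \<theta>: "\<theta> \<in> {lo..hi}"
  shows "integrable (joint_law F n X (\<lambda>_. \<theta>)) (\<lambda>y. (mle k y - \<theta>)\<^sup>2)"
    and "(\<integral>y. (mle k y - \<theta>)\<^sup>2 \<partial>joint_law F n X (\<lambda>_. \<theta>)) \<le> 1 / (C' \<theta> * N k)"
proof -
  let ?Q = "joint_law F n X (\<lambda>_. \<theta>)"
  have Npos: "0 < N k" by (rule N_pos[OF k])
  let ?S = "\<lambda>y. \<Sum>i\<in>{1..n}. w k i * (y i - \<theta>)"
  have S: "integrable ?Q (\<lambda>y. (?S y)\<^sup>2)"
    "(\<integral>y. (?S y)\<^sup>2 \<partial>?Q) = (\<Sum>i\<in>{1..n}. \<integral>y. (w k i * (y - \<theta>))\<^sup>2 \<partial>law F \<theta>)"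
  proof -
    interpret prob_space "law F \<theta>" by (rule prob_space_law[OF \<theta>])
    have 1: "integrable (law F \<theta>) (\<lambda>y. c * (y - \<theta>))" for c
      using mean_law(1)[OF \<theta>] by simp
    have 2: "(\<integral>y. c * (y - \<theta>) \<partial>law F \<theta>) = 0" for c
      using integral_law_affine[OF \<theta>, of 1 \<theta>] by simp
    have 3: "integrable (law F \<theta>) (\<lambda>y. (c * (y - \<theta>))\<^sup>2)" for c
      using integrable_square_dev[OF \<theta>] by (simp add: power_mult_distrib)
    show "integrable ?Q (\<lambda>y. (?S y)\<^sup>2)"
      "(\<integral>y. (?S y)\<^sup>2 \<partial>?Q) = (\<Sum>i\<in>{1..n}. \<integral>y. (w k i * (y - \<theta>))\<^sup>2 \<partial>law F \<theta>)"
      unfolding joint_law_def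
      using integral_PiM_sum_square[of "{1..n}" "\<lambda>_. law F \<theta>" "\<lambda>i y. w k i * (y - \<theta>)"]
        prob_space_law[OF \<theta>] 1 2 3 by auto
  qed
  have meas: "(\<lambda>y. (mle k y - \<theta>)\<^sup>2) \<in> borel_measurable ?Q"
  proof -
    have [measurable]: "mle k \<in> borel_measurable ?Q"
      unfolding joint_law_def by (intro measurable_PiM_law mle_measurable k)
    show ?thesis by measurable
  qed
  \<comment> \<open>Almost surely no observation is left out, so the effective weight is the full
    local size.\<close>
  have "AE y in ?Q. \<forall>i\<in>{1..n}. 0 < base_dens F (y i)"
    unfolding joint_law_def
    by (intro AE_finite_allI AE_PiM_component prob_space_law \<theta> AE_base_dens_pos) auto
  then have le: "AE y in ?Q. (mle k y - \<theta>)\<^sup>2 \<le> (?S y)\<^sup>2 / (N k)\<^sup>2"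
  proof eventually_elim
    case (elim y)
    have A: "eff_weight n (w k) y = N k"
      unfolding eff_weight_def local_size_def using elim by (intro sum.cong) auto
    have T: "eff_sum n (w k) y = (\<Sum>i\<in>{1..n}. w k i * y i)"
      unfolding eff_sum_def using elim by (intro sum.cong) auto
    have "mle k y = clip ((\<Sum>i\<in>{1..n}. w k i * y i) / N k)"
      using local_mle_eq[of n "w k" y] w_bounds[OF k] Npos by (simp add: A T)
    then have "\<bar>mle k y - \<theta>\<bar> \<le> \<bar>(\<Sum>i\<in>{1..n}. w k i * y i) / N k - \<theta>\<bar>"
      using abs_clip_diff_le[OF \<theta>] by simp
    also have "(\<Sum>i\<in>{1..n}. w k i * y i) / N k - \<theta> = ?S y / N k"
      using Npos by (simp add: local_size_def field_simps sum_subtractf sum_distrib_left)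
    finally have "(mle k y - \<theta>)\<^sup>2 \<le> (?S y / N k)\<^sup>2"
      by (simp only: abs_le_square_iff)
    then show ?case by (simp add: power_divide)
  qed
  have int: "integrable ?Q (\<lambda>y. (?S y)\<^sup>2 / (N k)\<^sup>2)"
    using S(1) by simp
  show 1: "integrable ?Q (\<lambda>y. (mle k y - \<theta>)\<^sup>2)"
    using int meas by (rule Bochner_Integration.integrable_bound)
      (use le in \<open>auto elim!: eventually_mono\<close>)
  have "(\<integral>y. (mle k y - \<theta>)\<^sup>2 \<partial>?Q) \<le> (\<integral>y. (?S y)\<^sup>2 / (N k)\<^sup>2 \<partial>?Q)"
    using 1 int le by (rule integral_mono_AE)
  also have "\<dots> = (\<Sum>i\<in>{1..n}. (w k i)\<^sup>2) * var \<theta> / (N k)\<^sup>2"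
    using S(2) by (simp add: power_mult_distrib var_def sum_distrib_right)
  also have "\<dots> \<le> N k * var \<theta> / (N k)\<^sup>2"
  proof (intro divide_right_mono mult_right_mono)
    \<comment> \<open>Weights in [0,1] dominate their squares; this leaves a single power of
      \<open>N k\<close> in the denominator.\<close>
    have "(w k i)\<^sup>2 \<le> w k i" if "i \<in> {1..n}" for i
      using w_bounds[OF k that] by (simp add: power2_eq_square mult_left_le)
    then show "(\<Sum>i\<in>{1..n}. (w k i)\<^sup>2) \<le> N k"
      unfolding local_size_def by (intro sum_mono)
    show "0 \<le> var \<theta>" by (simp add: var_def)
  qed simp
  also have "\<dots> = var \<theta> * C' \<theta> / (C' \<theta> * N k)"
    using Npos C'_pos[OF \<theta>] by (simp add: power2_eq_square)
  finally show "(\<integral>y. (mle k y - \<theta>)\<^sup>2 \<partial>?Q) \<le> 1 / (C' \<theta> * N k)"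
    by (simp only: var_mult_C'[OF \<theta>])
qed

lemma KL_mle_agg_measurable:
  assumes "k \<in> {1..K}" "supp k \<subseteq> I"
  shows "(\<lambda>y. KL F (mle k y) (agg k y)) \<in> borel_measurable (PiM I (\<lambda>_. borel))"
  using assms mle_in agg_in
  by (intro KL_measurable mle_measurable agg_measurable) (auto simp: supp_def)

text \<open>The propagation condition bounds a Bochner integral, which would be 0 for a
  nonintegrable integrand. Integrability therefore has to be shown separately; it holds because the
  divergence is bounded on a compact interval.\<close>

lemma propagation_risk:
  assumes k: "k \<in> {1..K}" and \<theta>: "\<theta> \<in> {lo..hi}" and \<alpha>: "0 < \<alpha>"
    and propagation: "propagation_condition F n X K w Kag z \<alpha>"
  shows "integrable (joint_law F n X (\<lambda>_. \<theta>)) (\<lambda>y. KL F (mle k y) (agg k y))"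
    and "(\<integral>y. KL F (mle k y) (agg k y) \<partial>joint_law F n X (\<lambda>_. \<theta>)) \<le> \<alpha> * tau1 / N k"
proof -
  let ?Q = "joint_law F n X (\<lambda>_. \<theta>)"
  interpret Q: prob_space ?Q by (rule prob_space_joint) (rule \<theta>)
  obtain r where r: "r \<in> {lo..hi}" "\<And>r'. r' \<in> {lo..hi} \<Longrightarrow> C' r' \<le> C' r"
    using continuous_attains_sup[OF _ _ cont_C'] lo_less_hi by auto
  have "norm (KL F (mle k y) (agg k y)) \<le> C' r / 2 * (hi - lo)\<^sup>2" for y
  proof -
    note in' = mle_in[OF k, of y] agg_in[OF k, of y]
    have "KL F (mle k y) (agg k y) \<le> C' r / 2 * (agg k y - mle k y)\<^sup>2"
      by (rule KL_upper[OF in' r(2)])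
    also have "\<dots> \<le> C' r / 2 * (hi - lo)\<^sup>2"
      using in' C'_pos[OF r(1)] by (intro mult_left_mono abs_le_square_iff[THEN iffD1]) auto
    finally show ?thesis using KL_nonneg[OF in'] by simp
  qed
  moreover have "(\<lambda>y. KL F (mle k y) (agg k y)) \<in> borel_measurable ?Q"
    unfolding joint_law_def
    by (intro measurable_PiM_law KL_mle_agg_measurable k) (auto simp: supp_def)
  ultimately show int: "integrable ?Q (\<lambda>y. KL F (mle k y) (agg k y))"
    by (intro Q.integrable_const_bound[where B = "C' r / 2 * (hi - lo)\<^sup>2"]) auto
  show "(\<integral>y. KL F (mle k y) (agg k y) \<partial>?Q) \<le> \<alpha> * tau1 / N k"
  proof (cases "k = 1")
    \<comment> \<open>The propagation condition starts at 2. At step 1 the aggregated and the weak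
      estimate coincide.\<close>
    case True
    have "KL F (mle k y) (agg k y) = 0" for y
      by (simp only: True agg_1 KL_self)
    then show ?thesis
      using \<alpha> N_pos[OF k] by (simp add: tau1_def)
  next
    case False
    then have "k \<in> {2..K}" using k by auto
    then have "ereal (\<integral>y. N k * KL F (mle k y) (agg k y) \<partial>?Q) \<le> ereal (\<alpha> * tau1)"
      using propagation \<theta> unfolding propagation_condition_def params_eq SUP_le_iff by blast
    then show ?thesis
      using N_pos[OF k] by (simp add: field_simps)
  qed
qed

lemma aggregated_risk:
  assumes f: "\<And>x. f x \<in> {lo..hi}" and \<theta>: "\<theta> \<in> {lo..hi}" and ks: "ks \<in> {1..K}"
    and bias: "modeling_bias F n X f (w ks) \<theta> \<le> ereal \<Delta>"
    and \<alpha>: "0 < \<alpha>" "\<alpha> \<le> 1"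
    and propagation: "propagation_condition F n X K w Kag z \<alpha>"
    and A2: "cond_A2 F \<kappa>"
    and Z: "\<And>k. k \<in> {ks..K} \<Longrightarrow> z k \<le> Z"
  shows "sqrt (N ks) * (\<integral>y. sqrt (KL F (agg K y) \<theta>) \<partial>joint_law F n X f)
    \<le> \<kappa> * (2 * sqrt (tau1 * exp \<Delta>) + inverse (u powr (-1/2) - 1) * sqrt Z)"
proof -
  let ?J = "joint_law F n X f"
  interpret J: prob_space ?J by (rule prob_space_joint) (rule f)
  obtain r where r: "r \<in> {lo..hi}" "\<And>r'. r' \<in> {lo..hi} \<Longrightarrow> C' r' \<le> C' r"
    using continuous_attains_sup[OF _ _ cont_C'] lo_less_hi by auto
  obtain q where q: "q \<in> {lo..hi}" "\<And>r'. r' \<in> {lo..hi} \<Longrightarrow> C' q \<le> C' r'"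
    using continuous_attains_inf[OF _ _ cont_C'] lo_less_hi by auto
  define M m where "M = C' r" and "m = C' q"
  have mM: "0 < m" "0 < M" using C'_pos q(1) r(1) by (auto simp: m_def M_def)
  have "sqrt \<bar>fisher_info F r / fisher_info F q\<bar> \<le> \<kappa>"
    using A2 r(1) q(1) unfolding cond_A2_def params_eq by blast
  then have "sqrt M / sqrt m \<le> \<kappa>"
    using mM by (simp add: fisher_info_eq[OF r(1)] fisher_info_eq[OF q(1)] M_def m_def real_sqrt_divide)
  then have \<kappa>: "sqrt M \<le> \<kappa> * sqrt m" using mM by (simp add: divide_le_eq)
  have \<kappa>1: "1 \<le> \<kappa>" using A2 by (simp add: cond_A2_def)
  have K: "K \<in> {1..K}" using ks by simp
  have Npos: "0 < N ks" by (rule N_pos[OF ks])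
  define c where "c = inverse (u powr (-1/2) - 1) * sqrt Z"
  \<comment> \<open>One error is a plain distance, since its square is controlled by a variance; the
    other is a root of a divergence, since its square is controlled by the propagation
    condition.\<close>
  define h1 h2 where "h1 y = \<bar>mle ks y - \<theta>\<bar>" and "h2 y = sqrt (KL F (mle ks y) (agg ks y))" for y
  have h2sq: "(h2 y)\<^sup>2 = KL F (mle ks y) (agg ks y)" for y
    unfolding h2_def using KL_nonneg[OF mle_in agg_in, OF ks ks] by simp
  have mle_restrict: "mle ks (restrict y (supp ks)) = mle ks y" for y
    using w_bounds[OF ks] by (intro local_mle_cong) (force simp: supp_def)
  have agg_restrict: "agg ks (restrict y (supp ks)) = agg ks y" for y
    by (intro agg_cong ks) (simp add: supp_def)
  have h1: "integrable ?J h1" "integral\<^sup>L ?J h1 \<le> sqrt (1 / (C' \<theta> * N ks) * exp \<Delta>)"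
  proof -
    have meas: "h1 \<in> borel_measurable (PiM I (\<lambda>_. borel))" if "supp ks \<subseteq> I" for I
    proof -
      have [measurable]: "mle ks \<in> borel_measurable (PiM I (\<lambda>_. borel))"
        using that by (intro mle_measurable ks) (auto simp: supp_def)
      show ?thesis unfolding h1_def by measurable
    qed
    have dep: "h1 (restrict y (supp ks)) = h1 y" and pos: "0 \<le> h1 y"
      and sq: "(h1 y)\<^sup>2 = (mle ks y - \<theta>)\<^sup>2" for y
      by (simp_all add: h1_def mle_restrict)
    note T = risk_transfer[OF f \<theta> bias meas dep pos, unfolded sq, OF _ mle_risk[OF ks \<theta>]]
    show "integrable ?J h1" "integral\<^sup>L ?J h1 \<le> sqrt (1 / (C' \<theta> * N ks) * exp \<Delta>)"
      by (rule T; assumption)+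
  qed
  have h2: "integrable ?J h2" "integral\<^sup>L ?J h2 \<le> sqrt (\<alpha> * tau1 / N ks * exp \<Delta>)"
  proof -
    have meas: "h2 \<in> borel_measurable (PiM I (\<lambda>_. borel))" if "supp ks \<subseteq> I" for I
      unfolding h2_def using KL_mle_agg_measurable[OF ks that] by measurable
    have dep: "h2 (restrict y (supp ks)) = h2 y" for y
      by (simp add: h2_def mle_restrict agg_restrict)
    have pos: "0 \<le> h2 y" for y
      unfolding h2_def using KL_nonneg[OF mle_in agg_in, OF ks ks] by simp
    note T = risk_transfer[OF f \<theta> bias meas dep pos, unfolded h2sq,
        OF _ propagation_risk[OF ks \<theta> \<alpha>(1) propagation]]
    show "integrable ?J h2" "integral\<^sup>L ?J h2 \<le> sqrt (\<alpha> * tau1 / N ks * exp \<Delta>)"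
      by (rule T; assumption)+
  qed
  \<comment> \<open>The contribution of the steps after \<open>ks\<close> is a constant. Only
    \<open>h1\<close> and \<open>h2\<close> remain random, and both are determined by the
    observations in the support at \<open>ks\<close>.\<close>
  let ?bound = "\<lambda>y. \<kappa> * (c + sqrt (N ks) * h2 y + sqrt (m / 2) * (sqrt (N ks) * h1 y))"
  have c: "sqrt (m / 2) * (sqrt (N ks) * \<bar>agg K y - agg ks y\<bar>) \<le> c" for y
    unfolding c_def using q(2) by (intro agg_stability ks mM Z) (auto simp: m_def)
  have ptw: "sqrt (N ks) * sqrt (KL F (agg K y) \<theta>) \<le> ?bound y" for y
  proof -
    note aK = agg_in[OF K, of y] and ak = agg_in[OF ks, of y] and mk = mle_in[OF ks, of y]
    have "KL F (agg K y) \<theta> \<le> M / 2 * (\<theta> - agg K y)\<^sup>2"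
      unfolding M_def by (rule KL_upper[OF aK \<theta> r(2)])
    then have "sqrt (KL F (agg K y) \<theta>) \<le> sqrt (M / 2 * (\<theta> - agg K y)\<^sup>2)"
      by (rule real_sqrt_le_mono)
    also have "\<dots> = sqrt M / sqrt 2 * \<bar>\<theta> - agg K y\<bar>"
      by (simp add: real_sqrt_mult real_sqrt_divide)
    also have "\<dots> \<le> \<kappa> * sqrt m / sqrt 2 * \<bar>\<theta> - agg K y\<bar>"
      by (intro mult_right_mono divide_right_mono \<kappa>) auto
    also have "\<dots> = \<kappa> * sqrt (m / 2) * \<bar>\<theta> - agg K y\<bar>"
      by (simp add: real_sqrt_divide)
    finally have 1: "sqrt (N ks) * sqrt (KL F (agg K y) \<theta>)
        \<le> \<kappa> * (sqrt (m / 2) * (sqrt (N ks) * \<bar>\<theta> - agg K y\<bar>))"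
      using Npos mult_left_mono[of "sqrt (KL F (agg K y) \<theta>)" _ "sqrt (N ks)"]
      by (simp add: mult_ac)
    have "m / 2 * (agg ks y - mle ks y)\<^sup>2 \<le> KL F (mle ks y) (agg ks y)"
      unfolding m_def by (rule KL_lower[OF mk ak q(2)])
    then have "sqrt (m / 2 * (agg ks y - mle ks y)\<^sup>2) \<le> h2 y"
      unfolding h2_def by (rule real_sqrt_le_mono)
    then have 2: "sqrt (m / 2) * \<bar>agg ks y - mle ks y\<bar> \<le> h2 y"
      by (simp only: real_sqrt_mult real_sqrt_abs)
    have "\<bar>\<theta> - agg K y\<bar> \<le> \<bar>agg K y - agg ks y\<bar> + \<bar>agg ks y - mle ks y\<bar> + h1 y"
      by (simp add: h1_def)
    then have "sqrt (m / 2) * (sqrt (N ks) * \<bar>\<theta> - agg K y\<bar>) \<le>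
        sqrt (m / 2) * (sqrt (N ks) * (\<bar>agg K y - agg ks y\<bar> + \<bar>agg ks y - mle ks y\<bar> + h1 y))"
      using mM Npos by (intro mult_left_mono) auto
    also have "\<dots> = sqrt (m / 2) * (sqrt (N ks) * \<bar>agg K y - agg ks y\<bar>)
        + sqrt (N ks) * (sqrt (m / 2) * \<bar>agg ks y - mle ks y\<bar>)
        + sqrt (m / 2) * (sqrt (N ks) * h1 y)"
      by (simp only: distrib_left mult.left_commute)
    also have "\<dots> \<le> c + sqrt (N ks) * h2 y + sqrt (m / 2) * (sqrt (N ks) * h1 y)"
      using c 2 Npos mM by (intro add_mono mult_left_mono) auto
    finally have "\<kappa> * (sqrt (m / 2) * (sqrt (N ks) * \<bar>\<theta> - agg K y\<bar>)) \<le> ?bound y"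
      using \<kappa>1 by (intro mult_left_mono) auto
    with 1 show ?thesis by linarith
  qed
  have "sqrt (N ks) * (\<integral>y. sqrt (KL F (agg K y) \<theta>) \<partial>?J)
      = (\<integral>y. sqrt (N ks) * sqrt (KL F (agg K y) \<theta>) \<partial>?J)"
    by simp
  also have "\<dots> \<le> integral\<^sup>L ?J ?bound"
  \<comment> \<open>Only the bound is shown integrable: a nonintegrable left side would have
    integral 0, below the nonnegative bound.\<close>
  proof (rule integral_mono')
    show "integrable ?J ?bound" using h1(1) h2(1) by simp
    show "0 \<le> ?bound y" for y
      using ptw[of y] KL_nonneg[OF agg_in[OF K] \<theta>] Npos
      by (elim order_trans[rotated]) simp
  qed (rule ptw)
  also have "\<dots> = \<kappa> * (c + sqrt (N ks) * integral\<^sup>L ?J h2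
      + sqrt (m / 2) * (sqrt (N ks) * integral\<^sup>L ?J h1))"
    using h1(1) h2(1) by (simp add: J.prob_space)
  also have "\<dots> \<le> \<kappa> * (c + sqrt (tau1 * exp \<Delta>) + sqrt (tau1 * exp \<Delta>))"
  proof (intro mult_left_mono add_mono order_refl)
    have "sqrt (N ks) * integral\<^sup>L ?J h2 \<le> sqrt (N ks) * sqrt (\<alpha> * tau1 / N ks * exp \<Delta>)"
      using Npos by (intro mult_left_mono h2) auto
    also have "\<dots> = sqrt (\<alpha> * (tau1 * exp \<Delta>))"
      using Npos by (simp flip: real_sqrt_mult)
    also have "\<dots> \<le> sqrt (tau1 * exp \<Delta>)"
      using \<alpha> by (intro real_sqrt_le_mono mult_left_le_one_le) (auto simp: tau1_def)
    finally show "sqrt (N ks) * integral\<^sup>L ?J h2 \<le> sqrt (tau1 * exp \<Delta>)" .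
    \<comment> \<open>Since \<open>m \<le> C' \<theta>\<close>, this term is at most
      \<open>sqrt (exp \<Delta> / 2)\<close>; it is rounded up so that both random errors share one
      bound.\<close>
    have "sqrt (m / 2) * (sqrt (N ks) * integral\<^sup>L ?J h1)
        \<le> sqrt (m / 2) * (sqrt (N ks) * sqrt (1 / (C' \<theta> * N ks) * exp \<Delta>))"
      using Npos mM by (intro mult_left_mono h1) auto
    also have "\<dots> = sqrt (m / C' \<theta> * (exp \<Delta> / 2))"
      using Npos by (simp flip: real_sqrt_mult)
    also have "\<dots> \<le> sqrt (tau1 * exp \<Delta>)"
    proof (rule real_sqrt_le_mono)
      have tau1: "tau1 = 2" by (simp add: tau1_def)
      have "m / C' \<theta> \<le> 1" using q(2)[OF \<theta>] C'_pos[OF \<theta>] by (simp add: m_def)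
      then have "m / C' \<theta> * (exp \<Delta> / 2) \<le> 1 * (exp \<Delta> / 2)"
        by (intro mult_right_mono) auto
      then show "m / C' \<theta> * (exp \<Delta> / 2) \<le> tau1 * exp \<Delta>"
        using exp_gt_zero[of \<Delta>] unfolding tau1 by linarith
    qed
    finally show "sqrt (m / 2) * (sqrt (N ks) * integral\<^sup>L ?J h1) \<le> sqrt (tau1 * exp \<Delta>)" .
  qed (use \<kappa>1 in simp)
  finally show ?thesis by (simp add: c_def algebra_simps)
qed

end

section \<open>Single parameter value and the risk bound\<close>

text \<open>With one parameter there is no derivative to work with, so this case stays outside the
  locale. All weak estimates equal \<open>t\<close>, and so do their affine combinations, whatever
  the kernel returns.\<close>

lemma aggregate_singleton:
  assumes "params F = {t}" "1 \<le> k"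
  shows "aggregate F n w Kag z y k = t"
proof -
  have mle: "local_mle F n W y = t" for W
    using assms(1) unfolding local_mle_def arg_max_def
    by (intro some_equality) (auto simp: is_arg_max_def)
  show ?thesis
    using assms(2)
    by (induction k rule: dec_induct) (simp_all add: mle Let_def algebra_simps)
qed

theorem corollary5p5:
  fixes F :: expfam
    and X :: "nat \<Rightarrow> real ^ 'd"
    and f :: "real ^ 'd \<Rightarrow> real"
    and w :: "nat \<Rightarrow> nat \<Rightarrow> real"
    and Kag :: "real \<Rightarrow> real"
    and z :: "nat \<Rightarrow> real"
    and n K ks :: nat
    and \<kappa> u0 u b \<alpha> \<theta> \<Delta> :: real
  assumes "1 \<le> n" and "1 \<le> K"
    and "cond_A1 F" and "cond_A2 F \<kappa>"
    and "\<forall>x. f x \<in> params F"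
    and "localizing_schemes n K w" and "cond_A3 n K w u0 u"
    and "aggregation_kernel Kag b"
    and "0 < \<alpha>" and "\<alpha> \<le> 1"
    and "\<forall>k\<in>{1..K}. 0 < z k"
    and "propagation_condition F n X K w Kag z \<alpha>"
    and "ks \<in> {1..K}" and "\<theta> \<in> params F" and "0 \<le> \<Delta>"
    and "(MAX k\<in>{1..ks}. modeling_bias F n X f (w k) \<theta>) \<le> ereal \<Delta>"
  shows "sqrt (local_size n (w ks)) *
           (\<integral>y. sqrt (KL F (aggregate F n w Kag z y K) \<theta>) \<partial>joint_law F n X f)
         \<le> \<kappa> * (2 * sqrt (tau1 * exp \<Delta>)
                + sqrt ((inverse (u powr (-1/2) - 1))\<^sup>2 * (MAX l\<in>{ks..K}. z l)))"
proof -
  define Z where "Z = (MAX l\<in>{ks..K}. z l)"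
  have Z: "z k \<le> Z" if "k \<in> {ks..K}" for k
    unfolding Z_def using that by (intro Max_ge) auto
  have "0 < z ks" using assms(11,13) by blast
  then have Z0: "0 \<le> Z" using Z[of ks] assms(13) by simp
  have "0 < u" "u < 1" using assms(7) by (auto simp: cond_A3_def)
  \<comment> \<open>Makes c_u positive, so that the root of its square is c_u itself.\<close>
  then have "1 < u powr (-1/2)" using powr_less_mono2_neg[of "-1/2" u 1] by simp
  then have c: "sqrt ((inverse (u powr (-1/2) - 1))\<^sup>2 * Z) = inverse (u powr (-1/2) - 1) * sqrt Z"
    by (simp add: real_sqrt_mult)
  have \<kappa>: "1 \<le> \<kappa>" using assms(4) by (simp add: cond_A2_def)
  have "modeling_bias F n X f (w ks) \<theta> \<le> (MAX k\<in>{1..ks}. modeling_bias F n X f (w k) \<theta>)"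
    using assms(13) by (intro Max_ge) auto
  then have bias: "modeling_bias F n X f (w ks) \<theta> \<le> ereal \<Delta>"
    using assms(16) by (rule order_trans)
  have "compact (params F)" "connected (params F)"
    using assms(4) by (auto simp: cond_A2_def convex_connected)
  \<comment> \<open>A compact connected set of reals is a closed interval; it is nonempty because it
    contains \<theta>.\<close>
  then obtain lo hi where params: "params F = {lo..hi}"
    using connected_compact_interval_1[of "params F"] by auto
  then have "lo \<le> hi" using assms(14) by auto
  then consider "lo = hi" | "lo < hi" by linarith
  then show ?thesis
  proof cases
    case 1
    then have "params F = {\<theta>}" using params assms(14) by simp
    then have "aggregate F n w Kag z y K = \<theta>" for y
      by (rule aggregate_singleton) (rule assms(2))
    then have "(\<integral>y. sqrt (KL F (aggregate F n w Kag z y K) \<theta>) \<partial>joint_law F n X f) = 0"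
      by (simp add: KL_self)
    moreover have "0 \<le> \<kappa> * (2 * sqrt (tau1 * exp \<Delta>) + sqrt ((inverse (u powr (-1/2) - 1))\<^sup>2 * Z))"
      unfolding c using \<kappa> Z0 \<open>1 < u powr (-1/2)\<close>
      by (intro mult_nonneg_nonneg add_nonneg_nonneg) (simp_all add: tau1_def)
    ultimately show ?thesis by (simp only: mult_zero_right Z_def)
  next
    case 2
    obtain C' where C': "\<And>t. t \<in> {lo..hi} \<Longrightarrow> (comp_C F has_real_derivative C' t) (at t within {lo..hi})"
      "continuous_on {lo..hi} C'"
      using assms(3) unfolding cond_A1_def C1_within_def params by blast
    obtain B' where B': "\<And>t. t \<in> {lo..hi} \<Longrightarrow> (comp_B F has_real_derivative B' t) (at t within {lo..hi})"
      using assms(3) unfolding cond_A1_def C1_within_def params by blast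
    interpret aggregation F lo hi C' B' n K w Kag z u0 u b
    proof
      show "0 < fisher_info F t" if "t \<in> {lo..hi}" for t
        using assms(4) that by (simp add: cond_A2_def params)
    qed (fact assms(3,6,7,8) params 2 C' B' | use assms(11) in blast)+
    show ?thesis
      unfolding Z_def[symmetric] c
      by (rule aggregated_risk[OF _ _ assms(13) bias assms(9,10,12,4) Z])
        (use assms(5,14) in \<open>auto simp only: params\<close>)
  qed
qed

end
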